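(* Let $B$ be a group acting on a set $S$ and let $\{A_s\}_{s\in S}$ be a $B$-invariant family of groups. Let $G$ be the semidirect product $\left(\bigoplus_{s\in S}A_s\right)\rtimes B$, where $B$ acts on the direct sum by permuting the factors according to its action on $S$. Then $G$ has Property (NL) if and only if all of the following conditions are satisfied: (1) $B$ has Property (NL); (2) for every $s\in S$ fixed by $B$, $A_s$ has Property (NL); (3) for every $s\in S$ with a finite $B$-orbit, $A_s$ has no unbounded quasimorphism; (4) for every $s\in S$ with an infinite $B$-orbit, $A_s$ has no unbounded homomorphism to $\mathbb{R}$.
   Context: A family $\{A_s\}_{s\in S}$ is $B$-invariant if $A_{b\cdot s}=A_s$ for all $b\in B$, $s\in S$ (the groups along a $B$-orbit are copies of the same group); $B$ acts on $\bigoplus_{s}A_s$ by $(b\cdot a)_s=a_{b^{-1}s}$. A quasimorphism on a group $A$ is a map $q:A\to\mathbb{R}$ with $\sup_{g,h}|q(gh)-q(g)-q(h)|<\infty$. A hyperbolic space is a geodesic Gromov hyperbolic metric space (not necessarily proper); actions on hyperbolic spaces are by isometries. An element $g$ of a group acting on a hyperbolic space $X$ is loxodromic if $n\mapsto g^n x$, $n\in\mathbb{Z}$, is a quasi-isometric embedding for some (equivalently any) $x\in X$. A group has Property (NL) if none of its actions on hyperbolic spaces admits a loxodromic element. *)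

theory Defs
  imports
    "HOL-Analysis.Abstract_Metric_Spaces"
    "HOL-Algebra.Group_Action"
    "HOL-Algebra.Product_Groups"
begin

section \<open>Hyperbolic spaces\<close>

text \<open>Metric spaces are a carrier with a distance, as in the library locale \<open>Metric_space\<close>.\<close>

definition geodesic_segment_from_to ::
    "'x set \<Rightarrow> ('x \<Rightarrow> 'x \<Rightarrow> real) \<Rightarrow> 'x \<Rightarrow> 'x \<Rightarrow> (real \<Rightarrow> 'x) \<Rightarrow> bool" where
  "geodesic_segment_from_to M d x y c \<longleftrightarrow>
     c ` {0..d x y} \<subseteq> M \<and> c 0 = x \<and> c (d x y) = y \<and>
     (\<forall>s\<in>{0..d x y}. \<forall>t\<in>{0..d x y}. d (c s) (c t) = \<bar>s - t\<bar>)"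

definition geodesic_space :: "'x set \<Rightarrow> ('x \<Rightarrow> 'x \<Rightarrow> real) \<Rightarrow> bool" where
  "geodesic_space M d \<longleftrightarrow> (\<forall>x\<in>M. \<forall>y\<in>M. \<exists>c. geodesic_segment_from_to M d x y c)"

definition Gromov_product :: "('x \<Rightarrow> 'x \<Rightarrow> real) \<Rightarrow> 'x \<Rightarrow> 'x \<Rightarrow> 'x \<Rightarrow> real" where
  "Gromov_product d w x y = (d x w + d y w - d x y) / 2"

definition Gromov_hyperbolic :: "'x set \<Rightarrow> ('x \<Rightarrow> 'x \<Rightarrow> real) \<Rightarrow> bool" where
  "Gromov_hyperbolic M d \<longleftrightarrow>
     (\<exists>\<delta>\<ge>0. \<forall>w\<in>M. \<forall>x\<in>M. \<forall>y\<in>M. \<forall>z\<in>M.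
        Gromov_product d w x z \<ge> min (Gromov_product d w x y) (Gromov_product d w y z) - \<delta>)"

definition hyperbolic_space :: "'x set \<Rightarrow> ('x \<Rightarrow> 'x \<Rightarrow> real) \<Rightarrow> bool" where
  "hyperbolic_space M d \<longleftrightarrow> Metric_space M d \<and> geodesic_space M d \<and> Gromov_hyperbolic M d"

definition quasi_isometric_embedding ::
    "'x set \<Rightarrow> ('x \<Rightarrow> 'x \<Rightarrow> real) \<Rightarrow> 'y set \<Rightarrow> ('y \<Rightarrow> 'y \<Rightarrow> real) \<Rightarrow> ('x \<Rightarrow> 'y) \<Rightarrow> bool" where
  "quasi_isometric_embedding M d N e f \<longleftrightarrow>
     f ` M \<subseteq> N \<and>
     (\<exists>K\<ge>1. \<exists>C\<ge>0. \<forall>x\<in>M. \<forall>y\<in>M.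
        d x y / K - C \<le> e (f x) (f y) \<and> e (f x) (f y) \<le> K * d x y + C)"


section \<open>Isometric actions and Property (NL)\<close>

definition isometric_action ::
    "('g, 'k) monoid_scheme \<Rightarrow> 'x set \<Rightarrow> ('x \<Rightarrow> 'x \<Rightarrow> real) \<Rightarrow> ('g \<Rightarrow> 'x \<Rightarrow> 'x) \<Rightarrow> bool" where
  "isometric_action G M d \<rho> \<longleftrightarrow>
     group_action G M \<rho> \<and>
     (\<forall>g\<in>carrier G. \<forall>x\<in>M. \<forall>y\<in>M. d (\<rho> g x) (\<rho> g y) = d x y)"

definition loxodromic ::
    "('g, 'k) monoid_scheme \<Rightarrow> 'x set \<Rightarrow> ('x \<Rightarrow> 'x \<Rightarrow> real) \<Rightarrow> ('g \<Rightarrow> 'x \<Rightarrow> 'x) \<Rightarrow> 'g \<Rightarrow> bool" where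
  "loxodromic G M d \<rho> g \<longleftrightarrow>
     (\<exists>x\<in>M. quasi_isometric_embedding UNIV (\<lambda>m n. \<bar>real_of_int m - real_of_int n\<bar>) M d
              (\<lambda>n::int. \<rho> (g [^]\<^bsub>G\<^esub> n) x))"

text \<open>
  A definition in HOL cannot quantify over all types, so the hyperbolic spaces here are those whose
  carrier is a subset of \<open>'g \<times> real\<close>, where \<open>'g\<close> is the type of the group elements.  Nothing
  is lost: the lemma \<open>property_NL_all_spaces\<close> below shows that this already excludes
  loxodromic elements for actions on hyperbolic spaces over every type \<open>'x\<close>.
\<close>

definition property_NL :: "('g, 'k) monoid_scheme \<Rightarrow> bool" where
  "property_NL G \<longleftrightarrow>
     (\<forall>(M :: ('g \<times> real) set) d \<rho>.
        hyperbolic_space M d \<and> isometric_action G M d \<rho> \<longrightarrow>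
        \<not> (\<exists>g\<in>carrier G. loxodromic G M d \<rho> g))"


section \<open>Quasimorphisms and homomorphisms to the reals\<close>

definition quasimorphism :: "('g, 'k) monoid_scheme \<Rightarrow> ('g \<Rightarrow> real) \<Rightarrow> bool" where
  "quasimorphism G q \<longleftrightarrow>
     bdd_above {\<bar>q (g \<otimes>\<^bsub>G\<^esub> h) - q g - q h\<bar> | g h. g \<in> carrier G \<and> h \<in> carrier G}"

definition real_group :: "real monoid" where
  "real_group = \<lparr>carrier = UNIV, mult = (+), one = 0\<rparr>"


section \<open>Permutational semidirect products\<close>

definition invariant_family ::
    "('b, 'k) monoid_scheme \<Rightarrow> 's set \<Rightarrow> ('b \<Rightarrow> 's \<Rightarrow> 's) \<Rightarrow> ('s \<Rightarrow> 'a monoid) \<Rightarrow> bool" where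
  "invariant_family B S \<phi> A \<longleftrightarrow>
     (\<forall>s\<in>S. group (A s)) \<and> (\<forall>b\<in>carrier B. \<forall>s\<in>S. A (\<phi> b s) = A s)"

text \<open>The restriction to \<open>S\<close> matches the library's \<open>sum_group\<close>, whose elements are extensional.\<close>

definition permute_factors ::
    "('b, 'k) monoid_scheme \<Rightarrow> 's set \<Rightarrow> ('b \<Rightarrow> 's \<Rightarrow> 's) \<Rightarrow> 'b \<Rightarrow> ('s \<Rightarrow> 'a) \<Rightarrow> 's \<Rightarrow> 'a" where
  "permute_factors B S \<phi> b a = (\<lambda>s\<in>S. a (\<phi> (inv\<^bsub>B\<^esub> b) s))"

definition semidirect_product ::
    "('n, 'k) monoid_scheme \<Rightarrow> ('b, 'l) monoid_scheme \<Rightarrow> ('b \<Rightarrow> 'n \<Rightarrow> 'n) \<Rightarrow> ('n \<times> 'b) monoid" where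
  "semidirect_product N B \<theta> =
     \<lparr>carrier = carrier N \<times> carrier B,
      mult = (\<lambda>(n, b) (n', b'). (n \<otimes>\<^bsub>N\<^esub> \<theta> b n', b \<otimes>\<^bsub>B\<^esub> b')),
      one = (\<one>\<^bsub>N\<^esub>, \<one>\<^bsub>B\<^esub>)\<rparr>"

definition permutational_product ::
    "('b, 'k) monoid_scheme \<Rightarrow> 's set \<Rightarrow> ('b \<Rightarrow> 's \<Rightarrow> 's) \<Rightarrow> ('s \<Rightarrow> 'a monoid) \<Rightarrow> (('s \<Rightarrow> 'a) \<times> 'b) monoid" where
  "permutational_product B S \<phi> A =
     semidirect_product (sum_group S A) B (permute_factors B S \<phi>)"

lemma group_permutational_product:
  assumes act: "group_action B S \<phi>" and fam: "invariant_family B S \<phi> A"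
  shows "group (permutational_product B S \<phi> A)"
proof -
  interpret act: group_action B S \<phi> by (rule act)
  interpret B: group B using act.group_hom by (simp add: group_hom_def)
  define N where "N = sum_group S A"
  let ?p = "permute_factors B S \<phi>"
  have gA: "group (A s)" if "s \<in> S" for s
    using fam that by (simp add: invariant_family_def)
  have A_inv: "A (\<phi> b s) = A s" if "b \<in> carrier B" "s \<in> S" for b s
    using fam that by (simp add: invariant_family_def)
  have phi_S: "\<phi> b s \<in> S" if "b \<in> carrier B" "s \<in> S" for b s
    using act.element_image that by blast
  have phi_m: "\<phi> (b \<otimes>\<^bsub>B\<^esub> c) s = \<phi> b (\<phi> c s)"
    if "b \<in> carrier B" "c \<in> carrier B" "s \<in> S" for b c s
    using act.composition_rule that by simp
  have phi_1: "\<phi> \<one>\<^bsub>B\<^esub> s = s" if "s \<in> S" for s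
    using act.id_eq_one that by (metis restrict_apply')
  interpret N: group N unfolding N_def using gA by simp
  have N_carrier: "carrier N = {x \<in> \<Pi>\<^sub>E i\<in>S. carrier (A i). finite {i \<in> S. x i \<noteq> \<one>\<^bsub>A i\<^esub>}}"
    unfolding N_def using gA by (rule carrier_sum_group)
  have N_mult: "x \<otimes>\<^bsub>N\<^esub> y = (\<lambda>s\<in>S. x s \<otimes>\<^bsub>A s\<^esub> y s)" for x y
    unfolding N_def by simp
  have closed: "?p b a \<in> carrier N" if b: "b \<in> carrier B" and a: "a \<in> carrier N" for b a
  proof -
    let ?i = "inv\<^bsub>B\<^esub> b"
    have i: "?i \<in> carrier B" using b by simp
    have sub: "{s \<in> S. ?p b a s \<noteq> \<one>\<^bsub>A s\<^esub>} \<subseteq> \<phi> b ` {s \<in> S. a s \<noteq> \<one>\<^bsub>A s\<^esub>}"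
    proof
      fix s assume "s \<in> {s \<in> S. ?p b a s \<noteq> \<one>\<^bsub>A s\<^esub>}"
      then have s: "s \<in> S" and ne: "a (\<phi> ?i s) \<noteq> \<one>\<^bsub>A (\<phi> ?i s)\<^esub>"
        using A_inv[OF i] by (auto simp: permute_factors_def)
      have "s = \<phi> b (\<phi> ?i s)"
        using phi_m[OF b i s] phi_1[OF s] b by simp
      then show "s \<in> \<phi> b ` {s \<in> S. a s \<noteq> \<one>\<^bsub>A s\<^esub>}"
        using ne phi_S[OF i s] by blast
    qed
    have fin: "finite {s \<in> S. a s \<noteq> \<one>\<^bsub>A s\<^esub>}"
      using a by (simp add: N_carrier)
    have "finite {s \<in> S. ?p b a s \<noteq> \<one>\<^bsub>A s\<^esub>}"
      by (rule finite_subset[OF sub finite_imageI[OF fin]])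
    moreover have "?p b a s \<in> carrier (A s)" if s: "s \<in> S" for s
    proof -
      have "a (\<phi> ?i s) \<in> carrier (A (\<phi> ?i s))"
        using a phi_S[OF i s] by (simp add: N_carrier PiE_iff)
      then show ?thesis using A_inv[OF i s] s by (simp add: permute_factors_def)
    qed
    ultimately show ?thesis
      by (simp add: N_carrier PiE_iff) (simp add: permute_factors_def)
  qed
  have p_mult: "?p b (x \<otimes>\<^bsub>N\<^esub> y) = ?p b x \<otimes>\<^bsub>N\<^esub> ?p b y" if b: "b \<in> carrier B" for b x y
    using phi_S A_inv b by (auto simp: N_mult permute_factors_def fun_eq_iff)
  have p_comp: "?p (b \<otimes>\<^bsub>B\<^esub> c) x = ?p b (?p c x)"
    if "b \<in> carrier B" "c \<in> carrier B" for b c x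
    using that phi_S phi_m by (auto simp: permute_factors_def fun_eq_iff B.inv_mult_group)
  have p_1: "?p \<one>\<^bsub>B\<^esub> x = x" if "x \<in> carrier N" for x
    using that phi_1 by (auto simp: permute_factors_def fun_eq_iff N_carrier PiE_iff extensional_def)
  show ?thesis
    unfolding permutational_product_def semidirect_product_def N_def[symmetric]
  proof (rule groupI, goal_cases)
    case (1 x y)
    then show ?case using closed by auto
  next
    case 2
    then show ?case by simp
  next
    case (3 x y z)
    then show ?case using closed by (auto simp: p_mult p_comp N.m_assoc B.m_assoc)
  next
    case (4 x)
    then show ?case using p_1 by auto
  next
    case (5 x)
    then obtain n b where x: "x = (n, b)" "n \<in> carrier N" "b \<in> carrier B" by auto
    let ?i = "inv\<^bsub>B\<^esub> b"
    have "?p ?i (inv\<^bsub>N\<^esub> n) \<otimes>\<^bsub>N\<^esub> ?p ?i n = ?p ?i \<one>\<^bsub>N\<^esub>"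
      using x p_mult[of ?i "inv\<^bsub>N\<^esub> n" n] by simp
    also have "\<dots> = \<one>\<^bsub>N\<^esub>"
      using x p_mult[of ?i "\<one>\<^bsub>N\<^esub>" "\<one>\<^bsub>N\<^esub>"] closed[of ?i "\<one>\<^bsub>N\<^esub>"] N.l_cancel_one by auto
    finally show ?case
      using x closed[of ?i "inv\<^bsub>N\<^esub> n"] by (intro bexI[of _ "(?p ?i (inv\<^bsub>N\<^esub> n), ?i)"]) auto
  qed
qed


section \<open>Property (NL) does not depend on the type of the spaces\<close>

lemma invariant_geodesic_subspace:
  fixes G :: "('g, 'k) monoid_scheme" and M :: "'x set"
  assumes hyp: "hyperbolic_space M d" and act: "isometric_action G M d \<rho>" and x0: "x0 \<in> M"
  obtains Y where "x0 \<in> Y" "Y \<subseteq> M" "geodesic_space Y d"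
    "\<And>g y. g \<in> carrier G \<Longrightarrow> y \<in> Y \<Longrightarrow> \<rho> g y \<in> Y"
    "\<exists>f :: 'x \<Rightarrow> 'g \<times> real. inj_on f Y"
proof -
  include cardinal_syntax
  have "\<forall>x y. \<exists>c. x \<in> M \<longrightarrow> y \<in> M \<longrightarrow> geodesic_segment_from_to M d x y c"
    using hyp by (auto simp: hyperbolic_space_def geodesic_space_def)
  then obtain c where c: "\<And>x y. x \<in> M \<Longrightarrow> y \<in> M \<Longrightarrow> geodesic_segment_from_to M d x y (c x y)"
    by metis
  define T where "T Z = Z \<union> (\<lambda>(g, y). \<rho> g y) ` (carrier G \<times> Z) \<union>
      (\<lambda>((x, y), t). c x y t) ` (SIGMA p:Z \<times> Z. {0..d (fst p) (snd p)})" for Z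
  define Y where "Y n = (T ^^ n) {x0}" for n
  let ?Y = "\<Union>n. Y n"
  let ?U = "UNIV :: ('g \<times> real) set"
  have inf: "\<not> finite ?U"
    using infinite_UNIV_char_0[where ?'a = real] by (auto simp: UNIV_Times_UNIV[symmetric] finite_cartesian_product_iff simp del: UNIV_Times_UNIV)
  have Suc: "Y (Suc n) = T (Y n)" for n by (simp add: Y_def)
  have Yle: "Y n \<subseteq> Y (Suc n)" for n unfolding Suc by (auto simp: T_def)
  have mono: "Y m \<subseteq> Y n" if "m \<le> n" for m n
    using lift_Suc_mono_le[of Y, OF Yle that] .
  have rho_M: "\<rho> g y \<in> M" if "g \<in> carrier G" "y \<in> M" for g y
    using act that group_action.element_image by (fastforce simp: isometric_action_def)
  have YM: "Y n \<subseteq> M" for n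
  proof (induction n)
    case 0 show ?case using x0 by (simp add: Y_def)
  next
    case (Suc n)
    have "c x y t \<in> M" if "x \<in> Y n" "y \<in> Y n" "t \<in> {0..d x y}" for x y t
      using c[of x y] subsetD[OF Suc that(1)] subsetD[OF Suc that(2)] that(3)
      unfolding geodesic_segment_from_to_def by blast
    then show ?case unfolding \<open>Y (Suc n) = T (Y n)\<close> using Suc rho_M by (auto simp: T_def)
  qed
  have rleU: "|UNIV :: real set| \<le>o |?U|"
    by (rule card_of_ordLeqI[of "\<lambda>r. (undefined, r)"]) (auto intro: inj_onI)
  have gleU: "|carrier G| \<le>o |?U|"
    by (rule card_of_ordLeqI[of "\<lambda>g. (g, 0)"]) (auto intro: inj_onI)
  have times: "|P \<times> Q| \<le>o |?U|" if "|P| \<le>o |?U|" "|Q| \<le>o |?U|" for P :: "'p set" and Q :: "'q set"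
    using card_of_Times_ordLeq_infinite_Field[of "|?U|" P Q] inf that
    by (simp add: Field_card_of card_of_card_order_on)
  have un: "|P \<union> Q| \<le>o |?U|" if "|P| \<le>o |?U|" "|Q| \<le>o |?U|" for P Q :: "'x set"
    using card_of_Un_ordLeq_infinite_Field[of "|?U|" P Q] inf that
    by (simp add: Field_card_of card_of_card_order_on)
  have small: "|Y n| \<le>o |?U|" for n
  proof (induction n)
    case 0
    show ?case unfolding Y_def by (rule card_of_ordLeqI[of "\<lambda>_. undefined"]) auto
  next
    case (Suc n)
    have "|(SIGMA p:Y n \<times> Y n. {0..d (fst p) (snd p)})| \<le>o |(Y n \<times> Y n) \<times> (UNIV :: real set)|"
      by (rule card_of_mono1) auto
    also have "|(Y n \<times> Y n) \<times> (UNIV :: real set)| \<le>o |?U|"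
      by (intro times Suc rleU)
    finally (ordLeq_transitive) have "|(SIGMA p:Y n \<times> Y n. {0..d (fst p) (snd p)})| \<le>o |?U|" .
    then show ?case
      unfolding \<open>Y (Suc n) = T (Y n)\<close> T_def
      by (intro un Suc ordLeq_transitive[OF card_of_image] times gleU)
  qed
  have nat: "|UNIV :: nat set| \<le>o |?U|"
    using inf infinite_iff_card_of_nat by blast
  have "|?Y| \<le>o |?U|"
    using card_of_UNION_ordLeq_infinite[OF inf nat] small by blast
  then have inj: "\<exists>f :: 'x \<Rightarrow> 'g \<times> real. inj_on f ?Y"
    using card_of_ordLeq[of ?Y ?U] by blast
  show thesis
  proof (rule that[of ?Y])
    show "x0 \<in> ?Y" using UN_I[of 0 UNIV x0 Y] by (simp add: Y_def)
    show "?Y \<subseteq> M" using YM by blast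
    show "\<exists>f :: 'x \<Rightarrow> 'g \<times> real. inj_on f ?Y" by (rule inj)
    show "\<rho> g y \<in> ?Y" if g: "g \<in> carrier G" and y: "y \<in> ?Y" for g y
    proof -
      obtain n where "y \<in> Y n" using y by blast
      then have "\<rho> g y \<in> Y (Suc n)" unfolding Suc using g by (force simp: T_def)
      then show ?thesis by blast
    qed
    show "geodesic_space ?Y d"
      unfolding geodesic_space_def
    proof (intro ballI)
      fix x y assume "x \<in> ?Y" "y \<in> ?Y"
      then obtain k l where "x \<in> Y k" "y \<in> Y l" by blast
      then have xy: "x \<in> Y (max k l)" "y \<in> Y (max k l)"
        using mono[of k "max k l"] mono[of l "max k l"] by auto
      then have geo: "geodesic_segment_from_to M d x y (c x y)"
        using c YM by blast
      have "c x y t \<in> Y (Suc (max k l))" if "t \<in> {0..d x y}" for t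
        unfolding Suc using xy that by (force simp: T_def)
      then have "c x y ` {0..d x y} \<subseteq> ?Y" by blast
      then show "\<exists>c. geodesic_segment_from_to ?Y d x y c"
        using geo unfolding geodesic_segment_from_to_def by blast
    qed
  qed
qed

lemma property_NL_all_spaces:
  fixes G :: "('g, 'k) monoid_scheme" and M :: "'x set"
  assumes NL: "property_NL G"
    and hyp: "hyperbolic_space M d" and act: "isometric_action G M d \<rho>"
  shows "\<not> (\<exists>g\<in>carrier G. loxodromic G M d \<rho> g)"
proof
  assume "\<exists>g\<in>carrier G. loxodromic G M d \<rho> g"
  then obtain g x0 where g: "g \<in> carrier G" and x0: "x0 \<in> M"
    and qie: "quasi_isometric_embedding UNIV (\<lambda>m n. \<bar>real_of_int m - real_of_int n\<bar>) M d
              (\<lambda>n::int. \<rho> (g [^]\<^bsub>G\<^esub> n) x0)"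
    by (auto simp: loxodromic_def)
  interpret ga: group_action G M \<rho> using act by (simp add: isometric_action_def)
  interpret G: group G using ga.group_hom by (simp add: group_hom_def)
  obtain Y and f :: "'x \<Rightarrow> 'g \<times> real" where Y: "x0 \<in> Y" "Y \<subseteq> M" "geodesic_space Y d"
    "\<And>g y. g \<in> carrier G \<Longrightarrow> y \<in> Y \<Longrightarrow> \<rho> g y \<in> Y" and f: "inj_on f Y"
    using invariant_geodesic_subspace[OF hyp act x0] by metis
  define h where "h = inv_into Y f"
  define N where "N = f ` Y"
  define e where "e u v = d (h u) (h v)" for u v
  define \<sigma> where "\<sigma> g = (\<lambda>u\<in>N. f (\<rho> g (h u)))" for g
  have hf: "h (f y) = y" if "y \<in> Y" for y using f that by (simp add: h_def)
  have hN: "h u \<in> Y" if "u \<in> N" for u using that hf by (auto simp: N_def)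
  have fN: "f y \<in> N" if "y \<in> Y" for y using that by (simp add: N_def)
  have fh: "f (h u) = u" if "u \<in> N" for u using that hf by (auto simp: N_def)
  have ms: "Metric_space M d" using hyp by (simp add: hyperbolic_space_def)
  have comp: "\<rho> (a \<otimes>\<^bsub>G\<^esub> b) y = \<rho> a (\<rho> b y)"
    if "a \<in> carrier G" "b \<in> carrier G" "y \<in> Y" for a b y
    using that ga.composition_rule Y(2) by blast
  have one: "\<rho> \<one>\<^bsub>G\<^esub> y = y" if "y \<in> Y" for y
    using ga.id_eq_one that Y(2) by (metis restrict_apply' subsetD)
  have "Metric_space N e"
  proof -
    interpret Metric_space M d by (rule ms)
    show ?thesis
    proof
      show "0 \<le> e x y" for x y by (simp add: e_def)
      show "e x y = e y x" for x y by (simp add: e_def commute)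
      show "e x y = 0 \<longleftrightarrow> x = y" if "x \<in> N" "y \<in> N" for x y
        using that hN Y(2) fh unfolding e_def by (metis zero subsetD)
      show "e x z \<le> e x y + e y z" if "x \<in> N" "y \<in> N" "z \<in> N" for x y z
        unfolding e_def using that hN Y(2) by (meson triangle subsetD)
    qed
  qed
  moreover have "geodesic_space N e"
    unfolding geodesic_space_def
  proof (intro ballI)
    fix u v assume uv: "u \<in> N" "v \<in> N"
    then obtain c where c: "geodesic_segment_from_to Y d (h u) (h v) c"
      using Y(3) hN[OF uv(1)] hN[OF uv(2)] unfolding geodesic_space_def by blast
    then have cY: "c t \<in> Y" if "t \<in> {0..d (h u) (h v)}" for t
      using that by (auto simp: geodesic_segment_from_to_def)
    have "geodesic_segment_from_to N e u v (f \<circ> c)"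
      unfolding geodesic_segment_from_to_def e_def
    proof (intro conjI ballI)
      show "(f \<circ> c) ` {0..d (h u) (h v)} \<subseteq> N" using cY fN by auto
      show "(f \<circ> c) 0 = u" "(f \<circ> c) (d (h u) (h v)) = v"
        using c uv fh by (auto simp: geodesic_segment_from_to_def)
      show "d (h ((f \<circ> c) s)) (h ((f \<circ> c) t)) = \<bar>s - t\<bar>"
        if "s \<in> {0..d (h u) (h v)}" "t \<in> {0..d (h u) (h v)}" for s t
        using c that cY by (simp add: hf geodesic_segment_from_to_def)
    qed
    then show "\<exists>c. geodesic_segment_from_to N e u v c" by blast
  qed
  moreover have "Gromov_hyperbolic N e"
  proof -
    obtain \<delta> where \<delta>: "\<delta> \<ge> 0" and
      gh: "\<And>w x y z. w \<in> M \<Longrightarrow> x \<in> M \<Longrightarrow> y \<in> M \<Longrightarrow> z \<in> M \<Longrightarrow>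
        Gromov_product d w x z \<ge> min (Gromov_product d w x y) (Gromov_product d w y z) - \<delta>"
      using hyp unfolding hyperbolic_space_def Gromov_hyperbolic_def by blast
    have prod: "Gromov_product e w x y = Gromov_product d (h w) (h x) (h y)" for w x y
      by (simp add: Gromov_product_def e_def)
    have "h u \<in> M" if "u \<in> N" for u using hN that Y(2) by blast
    then show ?thesis
      unfolding Gromov_hyperbolic_def prod using \<delta> gh by blast
  qed
  ultimately have "hyperbolic_space N e" by (simp add: hyperbolic_space_def)
  moreover have "isometric_action G N e \<sigma>"
    unfolding isometric_action_def
  proof (intro conjI ballI)
    have \<sigma>N: "\<sigma> a u \<in> N" if "a \<in> carrier G" "u \<in> N" for a u
      using that Y(4) hN fN by (simp add: \<sigma>_def)
    have \<sigma>m: "\<sigma> (a \<otimes>\<^bsub>G\<^esub> b) u = \<sigma> a (\<sigma> b u)"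
      if "a \<in> carrier G" "b \<in> carrier G" "u \<in> N" for a b u
      using that comp hN Y(4) fN hf by (simp add: \<sigma>_def)
    have \<sigma>1: "\<sigma> \<one>\<^bsub>G\<^esub> u = u" if "u \<in> N" for u
      using that one hN fh by (simp add: \<sigma>_def)
    have bij: "\<sigma> a \<in> Bij N" if a: "a \<in> carrier G" for a
    proof -
      have "bij_betw (\<sigma> a) N N"
      proof (rule bij_betw_byWitness[where f' = "\<sigma> (inv\<^bsub>G\<^esub> a)"])
        show "\<forall>u\<in>N. \<sigma> (inv\<^bsub>G\<^esub> a) (\<sigma> a u) = u" "\<forall>u\<in>N. \<sigma> a (\<sigma> (inv\<^bsub>G\<^esub> a) u) = u"
          using a \<sigma>m[symmetric] \<sigma>1 by simp_all
        show "\<sigma> a ` N \<subseteq> N" "\<sigma> (inv\<^bsub>G\<^esub> a) ` N \<subseteq> N"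
          using a \<sigma>N by auto
      qed
      then show ?thesis by (simp add: Bij_def \<sigma>_def)
    qed
    have "\<sigma> \<in> hom G (BijGroup N)"
    proof (rule homI)
      show "\<sigma> a \<in> carrier (BijGroup N)" if "a \<in> carrier G" for a
        using bij that by (simp add: BijGroup_def)
      show "\<sigma> (a \<otimes>\<^bsub>G\<^esub> b) = \<sigma> a \<otimes>\<^bsub>BijGroup N\<^esub> \<sigma> b"
        if "a \<in> carrier G" "b \<in> carrier G" for a b
        using that bij \<sigma>m by (auto simp: BijGroup_def compose_def fun_eq_iff) (simp add: \<sigma>_def)
    qed
    then show "group_action G N \<sigma>"
      by (simp add: group_action_def group_hom_def group_hom_axioms_def group_BijGroup)
    show "e (\<sigma> a u) (\<sigma> a v) = e u v" if "a \<in> carrier G" "u \<in> N" "v \<in> N" for a u v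
    proof -
      have "d (\<rho> a (h u)) (\<rho> a (h v)) = d (h u) (h v)"
        using act that hN Y(2) by (meson isometric_action_def subsetD)
      then show ?thesis using that hN Y(4) by (simp add: \<sigma>_def e_def hf)
    qed
  qed
  moreover have "loxodromic G N e \<sigma> g"
    unfolding loxodromic_def
  proof (rule bexI[of _ "f x0"])
    have orb: "\<rho> (g [^]\<^bsub>G\<^esub> n) x0 \<in> Y" for n :: int
      using Y(1,4) g by simp
    have sg: "\<sigma> (g [^]\<^bsub>G\<^esub> n) (f x0) = f (\<rho> (g [^]\<^bsub>G\<^esub> n) x0)" for n :: int
      using Y(1) fN hf by (simp add: \<sigma>_def)
    show "quasi_isometric_embedding UNIV (\<lambda>m n. \<bar>real_of_int m - real_of_int n\<bar>) N e
              (\<lambda>n::int. \<sigma> (g [^]\<^bsub>G\<^esub> n) (f x0))"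
      using qie orb unfolding quasi_isometric_embedding_def sg e_def
      by (auto simp: hf fN)
    show "f x0 \<in> N" using Y(1) fN by simp
  qed
  ultimately show False using NL g unfolding property_NL_def by blast
qed

end

theory Submission
  imports Defs
begin

text \<open>
  Both directions rest on the relation between loxodromic elements and quasimorphisms.

  \<^bold>\<open>The conditions are necessary.\<close> Property (NL) passes to quotients, and \<open>B\<close> as well as each factor
  \<open>A s\<close> with \<open>s\<close> fixed by \<open>B\<close> is a quotient of the product \<open>W\<close>. A group with Property (NL) has no unbounded
  quasimorphism: a homogeneous quasimorphism \<open>p\<close> gives an action on a quasi-line, a convex set of
  functions that agree with \<open>p\<close> up to a constant and a bounded error, on which every \<open>g\<close> with \<open>p g \<noteq> 0\<close> is
  loxodromic (\<open>property_NL_imp_quasimorphisms_bounded\<close>). A quasimorphism of \<open>A s\<close> on a finite orbit, or a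
  homomorphism to the reals on any orbit, yields a quasimorphism of \<open>W\<close> by summation over the orbit
  (\<open>quasimorphism_orbit_sum\<close>).

  \<^bold>\<open>The conditions are sufficient.\<close> An action of \<open>W\<close> on a hyperbolic space with a base point is
  replaced by the induced left-invariant pseudometric on \<open>W\<close>. Its main property is
  \<open>busemann_homogeneous_quasimorphism\<close>: the stabilizer of an end of a loxodromic element carries a
  homogeneous quasimorphism whose absolute value is the stable translation length \<open>\<tau>\<close>. Let \<open>g\<close> be a
  loxodromic element.

  If the direct sum contains no loxodromic element, then it fixes an end of \<open>g\<close>, the quasimorphism of
  that end vanishes on it, and the projection of \<open>g\<close> to \<open>B\<close> has the same translation length as \<open>g\<close>
  (\<open>translation_length_mod_normal\<close>). This contradicts Property (NL) of \<open>B\<close>.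

  If the direct sum contains a loxodromic element, then so does some factor \<open>A s\<close>, since \<open>\<tau>\<close> is
  subadditive on commuting elements. If \<open>B\<close> fixes \<open>s\<close>, this contradicts Property (NL) of \<open>A s\<close>. Otherwise
  a conjugate of \<open>A s\<close> in the direct sum contains a loxodromic element that commutes with \<open>A s\<close>, so that \<open>A s\<close>
  fixes its ends and has an unbounded quasimorphism. If the orbit of \<open>s\<close> is infinite, this quasimorphism
  extends to infinitely many conjugate copies of \<open>A s\<close> with the same absolute value; its defect on \<open>k\<close> copies
  is \<open>k\<close> times the defect on one copy, so the latter is zero and \<open>A s\<close> has an unbounded homomorphism to
  the reals (\<open>unbounded_hom_of_loxodromic_factor\<close>).
\<close>


section \<open>Quasimorphisms\<close>

text \<open>
  Applied to the powers of a group element, this turns an estimate with a bounded error into an exact one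
  for homogeneous quantities.
\<close>

lemma le_of_linear_growth_le:
  fixes a b C :: real
  assumes "\<And>n::nat. n \<ge> 1 \<Longrightarrow> n * a \<le> n * b + C"
  shows "a \<le> b"
proof (rule ccontr)
  assume "\<not> a \<le> b"
  then obtain n :: nat where n: "\<bar>C\<bar> + 1 < n * (a - b)"
    using reals_Archimedean3[of "a - b"] by auto
  then have "n \<ge> 1" by (cases n) auto
  then show False using assms[of n] n by (simp add: algebra_simps)
qed

lemma quasimorphismI:
  assumes "\<And>g h. g \<in> carrier G \<Longrightarrow> h \<in> carrier G \<Longrightarrow> \<bar>q (g \<otimes>\<^bsub>G\<^esub> h) - q g - q h\<bar> \<le> D"
  shows "quasimorphism G q"
  unfolding quasimorphism_def by (rule bdd_aboveI[of _ D]) (use assms in auto)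

lemma quasimorphismE:
  assumes "quasimorphism G q"
  obtains D where "D \<ge> 0"
    "\<And>g h. g \<in> carrier G \<Longrightarrow> h \<in> carrier G \<Longrightarrow> \<bar>q (g \<otimes>\<^bsub>G\<^esub> h) - q g - q h\<bar> \<le> D"
proof -
  obtain D where "\<forall>x\<in>{\<bar>q (g \<otimes>\<^bsub>G\<^esub> h) - q g - q h\<bar> | g h. g \<in> carrier G \<and> h \<in> carrier G}. x \<le> D"
    using assms unfolding quasimorphism_def bdd_above_def by blast
  then have "\<bar>q (g \<otimes>\<^bsub>G\<^esub> h) - q g - q h\<bar> \<le> max D 0"
    if "g \<in> carrier G" "h \<in> carrier G" for g h
    using that by (fastforce simp: max.coboundedI1)
  then show thesis using that[of "max D 0"] by simp
qed

lemma quasimorphism_perturb: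
  assumes "group G" "quasimorphism G q" "\<And>g. g \<in> carrier G \<Longrightarrow> \<bar>p g - q g\<bar> \<le> C"
  shows "quasimorphism G p"
proof -
  interpret group G by fact
  obtain D where D: "\<And>g h. g \<in> carrier G \<Longrightarrow> h \<in> carrier G \<Longrightarrow> \<bar>q (g \<otimes>\<^bsub>G\<^esub> h) - q g - q h\<bar> \<le> D"
    using quasimorphismE[OF assms(2)] by blast
  show ?thesis
  proof (rule quasimorphismI[where D = "D + 3 * C"])
    fix g h assume g: "g \<in> carrier G" and h: "h \<in> carrier G"
    show "\<bar>p (g \<otimes>\<^bsub>G\<^esub> h) - p g - p h\<bar> \<le> D + 3 * C"
      using D[OF g h] assms(3)[OF g] assms(3)[OF h] assms(3)[OF m_closed[OF g h]] by linarith
  qed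
qed

lemma (in group) quasimorphism_nat_pow:
  fixes q :: "'a \<Rightarrow> real"
  assumes D: "\<And>g h. g \<in> carrier G \<Longrightarrow> h \<in> carrier G \<Longrightarrow> \<bar>q (g \<otimes> h) - q g - q h\<bar> \<le> D"
    and g: "g \<in> carrier G"
  shows "\<bar>q (g [^] (n::nat)) - n * q g\<bar> \<le> (real n + 1) * D"
proof (induction n)
  case 0
  show ?case using D[of \<one> \<one>] by (simp add: abs_if split: if_splits)
next
  case (Suc n)
  then show ?case
    using D[of "g [^] n" g] g by (simp add: algebra_simps)
qed

definition homogeneous_quasimorphism :: "('g, 'k) monoid_scheme \<Rightarrow> ('g \<Rightarrow> real) \<Rightarrow> bool" where
  "homogeneous_quasimorphism G p \<longleftrightarrow>
     quasimorphism G p \<and> (\<forall>g\<in>carrier G. \<forall>n::nat. p (g [^]\<^bsub>G\<^esub> n) = real n * p g)"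

text \<open>
  The estimate for powers gives \<open>\<bar>q (g ^ (m * n)) / (m * n) - q (g ^ m) / m\<bar> \<le> 2 * D / m\<close>, so the
  averages \<open>q (g ^ n) / n\<close> form a Cauchy sequence; its limit stays within \<open>2 * D\<close> of the term
  with \<open>n = 1\<close>.
\<close>

lemma (in group) homogenization:
  assumes "quasimorphism G q"
  obtains p C where "homogeneous_quasimorphism G p" "\<And>g. g \<in> carrier G \<Longrightarrow> \<bar>p g - q g\<bar> \<le> C"
proof -
  obtain D where D0: "D \<ge> 0"
    and D: "\<And>g h. g \<in> carrier G \<Longrightarrow> h \<in> carrier G \<Longrightarrow> \<bar>q (g \<otimes> h) - q g - q h\<bar> \<le> D"
    using quasimorphismE[OF assms] by blast
  define a where "a g n = q (g [^] n) / n" for g and n :: nat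
  have step: "\<bar>a g (m * n) - a g m\<bar> \<le> 2 * D / m" if g: "g \<in> carrier G" and "m \<ge> 1" "n \<ge> 1" for g m n
  proof -
    have "\<bar>q (g [^] (m * n)) - n * q (g [^] m)\<bar> \<le> (n + 1) * D"
      using quasimorphism_nat_pow[OF D, of "g [^] m" n] g by (simp add: nat_pow_pow add.commute)
    moreover have "a g (m * n) - a g m = (q (g [^] (m * n)) - n * q (g [^] m)) / (m * n)"
      using that by (simp add: a_def field_simps)
    ultimately have "\<bar>a g (m * n) - a g m\<bar> \<le> (n + 1) * D / (m * n)"
      using that by (simp add: divide_right_mono)
    also have "\<dots> \<le> (2 * n) * D / (m * n)"
      using that D0 by (intro divide_right_mono mult_right_mono) auto
    also have "\<dots> = 2 * D / m" using that by simp
    finally show ?thesis .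
  qed
  have cauchy: "\<bar>a g m - a g n\<bar> \<le> 2 * D / m + 2 * D / n"
    if g: "g \<in> carrier G" and "m \<ge> 1" "n \<ge> 1" for g m n
    using step[OF that] step[OF g that(3,2)] by (simp add: mult.commute)
  have conv: "convergent (a g)" if g: "g \<in> carrier G" for g
    unfolding Cauchy_convergent_iff[symmetric]
  proof (rule metric_CauchyI)
    fix e :: real assume e: "e > 0"
    obtain N :: nat where "4 * D / e < N" using reals_Archimedean2 by blast
    then have N: "4 * D / (N + 1) < e" using e by (simp add: field_simps)
    have le: "2 * D / m \<le> 2 * D / (N + 1)" if "m \<ge> N + 1" for m
      using that D0 by (intro divide_left_mono) auto
    have "dist (a g m) (a g n) < e" if "m \<ge> N + 1" "n \<ge> N + 1" for m n
      using cauchy[OF g, of m n] le[OF that(1)] le[OF that(2)] N that by (simp add: dist_real_def)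
    then show "\<exists>M. \<forall>m\<ge>M. \<forall>n\<ge>M. dist (a g m) (a g n) < e" by blast
  qed
  define p where "p g = lim (a g)" for g
  have lim: "a g \<longlonglongrightarrow> p g" if "g \<in> carrier G" for g
    using conv[OF that] by (simp add: p_def convergent_LIMSEQ_iff)
  have close: "\<bar>p g - q g\<bar> \<le> 2 * D" if g: "g \<in> carrier G" for g
  proof -
    have "(\<lambda>n. \<bar>a g n - q g\<bar>) \<longlonglongrightarrow> \<bar>p g - q g\<bar>"
      by (intro tendsto_intros lim g)
    moreover have "\<forall>\<^sub>F n in sequentially. \<bar>a g n - q g\<bar> \<le> 2 * D"
      using step[OF g, of 1] g by (intro eventually_sequentiallyI[of 1]) (simp add: a_def)
    ultimately show ?thesis by (rule tendsto_upperbound) simp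
  qed
  have "p (g [^] k) = k * p g" if g: "g \<in> carrier G" for g and k :: nat
  proof (cases "k = 0")
    case True
    have "a \<one> = (\<lambda>n. q \<one> / n)" by (simp add: a_def fun_eq_iff)
    then have "a \<one> \<longlonglongrightarrow> 0" using lim_const_over_n[of "q \<one>"] by simp
    then show ?thesis using LIMSEQ_unique[OF lim[of \<one>]] True by simp
  next
    case False
    have "a (g [^] k) = (\<lambda>n. k * a g (k * n))"
      using False g by (simp add: a_def fun_eq_iff nat_pow_pow)
    moreover have "(\<lambda>n. k * a g (k * n)) \<longlonglongrightarrow> k * p g"
    proof (intro tendsto_intros)
      have "strict_mono (\<lambda>n. k * n)" using False by (simp add: strict_mono_def)
      then show "(\<lambda>n. a g (k * n)) \<longlonglongrightarrow> p g"
        using LIMSEQ_subseq_LIMSEQ[OF lim[OF g]] by (simp add: comp_def)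
    qed
    ultimately show ?thesis using LIMSEQ_unique[OF lim[of "g [^] k"]] g by simp
  qed
  then have "homogeneous_quasimorphism G p"
    unfolding homogeneous_quasimorphism_def
    using quasimorphism_perturb[OF is_group assms close] by blast
  then show thesis using that close by blast
qed

lemma homogeneous_quasimorphism_nat_pow:
  assumes "homogeneous_quasimorphism G p" "g \<in> carrier G"
  shows "p (g [^]\<^bsub>G\<^esub> (n::nat)) = n * p g"
  using assms by (simp add: homogeneous_quasimorphism_def)

text \<open>
  For commuting \<open>g\<close> and \<open>h\<close> the defect of \<open>(g, h)\<close> is an \<open>n\<close>-th part of the defect of
  \<open>(g ^ n, h ^ n)\<close>.
\<close>

lemma (in group) homogeneous_quasimorphism_commuting:
  assumes p: "homogeneous_quasimorphism G p"
    and g: "g \<in> carrier G" and h: "h \<in> carrier G" and comm: "g \<otimes> h = h \<otimes> g"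
  shows "p (g \<otimes> h) = p g + p h"
proof -
  obtain D where D: "\<And>g h. g \<in> carrier G \<Longrightarrow> h \<in> carrier G \<Longrightarrow> \<bar>p (g \<otimes> h) - p g - p h\<bar> \<le> D"
    using p quasimorphismE unfolding homogeneous_quasimorphism_def by metis
  note pow = homogeneous_quasimorphism_nat_pow[OF p]
  have "\<bar>p (g \<otimes> h) - p g - p h\<bar> \<le> 0"
  proof (rule le_of_linear_growth_le)
    fix n :: nat
    have "n * (p (g \<otimes> h) - p g - p h) = p (g [^] n \<otimes> h [^] n) - p (g [^] n) - p (h [^] n)"
      using pow[of "g \<otimes> h" n] pow[of g n] pow[of h n] pow_mult_distrib[OF comm g h] g h
      by (simp add: algebra_simps)
    then show "n * \<bar>p (g \<otimes> h) - p g - p h\<bar> \<le> n * (0::real) + D"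
      using D[of "g [^] n" "h [^] n"] g h abs_mult[of "real n"] by simp
  qed
  then show ?thesis by simp
qed

lemma (in group) homogeneous_quasimorphism_one:
  "homogeneous_quasimorphism G p \<Longrightarrow> p \<one> = 0"
  using homogeneous_quasimorphism_nat_pow[of G p \<one> 0] by simp

lemma (in group) homogeneous_quasimorphism_inv:
  assumes "homogeneous_quasimorphism G p" "g \<in> carrier G"
  shows "p (inv g) = - p g"
  using homogeneous_quasimorphism_commuting[OF assms(1), of g "inv g"] assms
    homogeneous_quasimorphism_one[OF assms(1)] by simp

lemma (in group) homogeneous_quasimorphism_int_pow:
  assumes "homogeneous_quasimorphism G p" "g \<in> carrier G"
  shows "p (g [^] (k::int)) = k * p g"
proof (cases "k \<ge> 0")
  case True
  then obtain n where "k = int n" using zero_le_imp_eq_int by blast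
  then show ?thesis using homogeneous_quasimorphism_nat_pow[OF assms, of n] by (simp add: int_pow_int)
next
  case False
  then obtain n where "k = - int n" by (metis int_cases4 nle_le zero_le_imp_eq_int of_nat_0_le_iff)
  then show ?thesis
    using homogeneous_quasimorphism_nat_pow[OF assms, of n] assms
      homogeneous_quasimorphism_inv[OF assms(1), of "g [^] n"]
    by (simp add: int_pow_neg_int)
qed

text \<open>
  Normalise \<open>p a = p' a = c > 0\<close>. For large \<open>n\<close> both functions are positive at \<open>a ^ n g\<close> and
  hence equal there, while their values differ from \<open>n * c + p g\<close> and \<open>n * c + p' g\<close> by at most the
  defects. So \<open>p - p'\<close> is bounded, and homogeneity makes it vanish.
\<close>

lemma (in group) homogeneous_quasimorphisms_eq_or_minus:
  assumes p: "homogeneous_quasimorphism G p" and p': "homogeneous_quasimorphism G p'"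
    and abs: "\<And>g. g \<in> carrier G \<Longrightarrow> \<bar>p g\<bar> = \<bar>p' g\<bar>"
  shows "(\<forall>g\<in>carrier G. p' g = p g) \<or> (\<forall>g\<in>carrier G. p' g = - p g)"
proof (cases "\<forall>g\<in>carrier G. p g = 0")
  case True
  then show ?thesis using abs by fastforce
next
  case False
  then obtain a where a: "a \<in> carrier G" "p a > 0"
    using homogeneous_quasimorphism_inv[OF p] by (metis inv_closed neg_0_less_iff_less linorder_less_linear)
  have eq: "r g = p g"
    if r: "homogeneous_quasimorphism G r" and ra: "r a = p a"
      and rabs: "\<And>g. g \<in> carrier G \<Longrightarrow> \<bar>p g\<bar> = \<bar>r g\<bar>" and g: "g \<in> carrier G" for r g
  proof -
    obtain D where D: "\<And>g h. g \<in> carrier G \<Longrightarrow> h \<in> carrier G \<Longrightarrow> \<bar>p (g \<otimes> h) - p g - p h\<bar> \<le> D"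
      using p quasimorphismE unfolding homogeneous_quasimorphism_def by metis
    obtain E where E: "\<And>g h. g \<in> carrier G \<Longrightarrow> h \<in> carrier G \<Longrightarrow> \<bar>r (g \<otimes> h) - r g - r h\<bar> \<le> E"
      using r quasimorphismE unfolding homogeneous_quasimorphism_def by metis
    have bound: "\<bar>r g - p g\<bar> \<le> D + E" if g: "g \<in> carrier G" for g
    proof -
      obtain n :: nat where n: "\<bar>p g\<bar> + \<bar>r g\<bar> + \<bar>D\<bar> + \<bar>E\<bar> < n * p a"
        using reals_Archimedean3[OF a(2)] by blast
      have "\<bar>p (a [^] n \<otimes> g) - n * p a - p g\<bar> \<le> D" "\<bar>r (a [^] n \<otimes> g) - n * p a - r g\<bar> \<le> E"
        using D[of "a [^] n" g] E[of "a [^] n" g] a g ra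
          homogeneous_quasimorphism_nat_pow[OF p a(1), of n]
          homogeneous_quasimorphism_nat_pow[OF r a(1), of n] by simp_all
      moreover have "\<bar>p (a [^] n \<otimes> g)\<bar> = \<bar>r (a [^] n \<otimes> g)\<bar>" using rabs a g by simp
      ultimately show ?thesis using n by linarith
    qed
    have "\<bar>r g - p g\<bar> \<le> 0"
    proof (rule le_of_linear_growth_le)
      fix n :: nat
      have "n * (r g - p g) = r (g [^] n) - p (g [^] n)"
        using homogeneous_quasimorphism_nat_pow[OF p g, of n]
          homogeneous_quasimorphism_nat_pow[OF r g, of n] by (simp add: algebra_simps)
      then show "n * \<bar>r g - p g\<bar> \<le> n * (0::real) + (D + E)"
        using bound[of "g [^] n"] g abs_mult[of "real n" "r g - p g"] by simp
    qed
    then show ?thesis by simp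
  qed
  have minus: "homogeneous_quasimorphism G (\<lambda>g. - p' g)"
  proof -
    obtain D where "\<And>g h. g \<in> carrier G \<Longrightarrow> h \<in> carrier G \<Longrightarrow> \<bar>p' (g \<otimes> h) - p' g - p' h\<bar> \<le> D"
      using p' quasimorphismE unfolding homogeneous_quasimorphism_def by metis
    then have "quasimorphism G (\<lambda>g. - p' g)"
      by (intro quasimorphismI[of _ _ D]) (smt (verit))
    then show ?thesis using p' by (simp add: homogeneous_quasimorphism_def)
  qed
  have "p' a = p a \<or> - p' a = p a" using abs[OF a(1)] by linarith
  then show ?thesis
  proof
    assume "p' a = p a"
    then show ?thesis using eq[OF p'] abs by blast
  next
    assume "- p' a = p a"
    then show ?thesis using eq[OF minus] abs by force
  qed
qed

lemma homogeneous_quasimorphism_comp_hom: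
  assumes p: "homogeneous_quasimorphism G p" and f: "f \<in> hom H G" and "group H" "group G"
  shows "homogeneous_quasimorphism H (\<lambda>h. p (f h))"
proof -
  interpret group_hom H G f using assms by (simp add: group_hom_def group_hom_axioms_def)
  obtain D where "\<And>g h. g \<in> carrier G \<Longrightarrow> h \<in> carrier G \<Longrightarrow> \<bar>p (g \<otimes>\<^bsub>G\<^esub> h) - p g - p h\<bar> \<le> D"
    using p quasimorphismE unfolding homogeneous_quasimorphism_def by metis
  then have "quasimorphism H (\<lambda>h. p (f h))"
    by (intro quasimorphismI[of _ _ D]) simp
  then show ?thesis
    using homogeneous_quasimorphism_nat_pow[OF p] by (simp add: homogeneous_quasimorphism_def hom_nat_pow)
qed

lemma (in group) homogeneous_quasimorphism_unbounded:
  assumes "homogeneous_quasimorphism G p" "g \<in> carrier G" "p g \<noteq> 0"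
  shows "\<not> bounded (p ` carrier G)"
proof
  assume "bounded (p ` carrier G)"
  then obtain C where C: "\<And>h. h \<in> carrier G \<Longrightarrow> \<bar>p h\<bar> \<le> C"
    by (auto simp: bounded_iff)
  have "\<bar>p g\<bar> \<le> 0"
  proof (rule le_of_linear_growth_le)
    fix n :: nat
    show "n * \<bar>p g\<bar> \<le> n * (0::real) + C"
      using C[of "g [^] n"] assms homogeneous_quasimorphism_nat_pow[OF assms(1,2), of n]
      by (simp add: abs_mult)
  qed
  then show False using assms(3) by simp
qed


section \<open>Isometric actions and Property (NL)\<close>

lemma isometric_actionI:
  assumes "group G"
    and ext: "\<And>g. g \<in> carrier G \<Longrightarrow> \<rho> g \<in> extensional M"
    and closed: "\<And>g x. g \<in> carrier G \<Longrightarrow> x \<in> M \<Longrightarrow> \<rho> g x \<in> M"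
    and mult: "\<And>g h x. g \<in> carrier G \<Longrightarrow> h \<in> carrier G \<Longrightarrow> x \<in> M \<Longrightarrow> \<rho> (g \<otimes>\<^bsub>G\<^esub> h) x = \<rho> g (\<rho> h x)"
    and one: "\<And>x. x \<in> M \<Longrightarrow> \<rho> \<one>\<^bsub>G\<^esub> x = x"
    and iso: "\<And>g x y. g \<in> carrier G \<Longrightarrow> x \<in> M \<Longrightarrow> y \<in> M \<Longrightarrow> d (\<rho> g x) (\<rho> g y) = d x y"
  shows "isometric_action G M d \<rho>"
proof -
  interpret group G by fact
  have bij: "\<rho> g \<in> Bij M" if g: "g \<in> carrier G" for g
  proof -
    have "bij_betw (\<rho> g) M M"
    proof (rule bij_betw_byWitness[where f' = "\<rho> (inv\<^bsub>G\<^esub> g)"])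
      show "\<forall>x\<in>M. \<rho> (inv\<^bsub>G\<^esub> g) (\<rho> g x) = x" "\<forall>x\<in>M. \<rho> g (\<rho> (inv\<^bsub>G\<^esub> g) x) = x"
        using g by (simp_all add: mult[symmetric] one)
      show "\<rho> g ` M \<subseteq> M" "\<rho> (inv\<^bsub>G\<^esub> g) ` M \<subseteq> M" using g closed by auto
    qed
    then show ?thesis using ext[OF g] by (simp add: Bij_def)
  qed
  have "\<rho> \<in> hom G (BijGroup M)"
  proof (rule homI)
    show "\<rho> g \<in> carrier (BijGroup M)" if "g \<in> carrier G" for g
      using bij that by (simp add: BijGroup_def)
    show "\<rho> (g \<otimes>\<^bsub>G\<^esub> h) = \<rho> g \<otimes>\<^bsub>BijGroup M\<^esub> \<rho> h" if "g \<in> carrier G" "h \<in> carrier G" for g h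
    proof
      fix x
      show "\<rho> (g \<otimes>\<^bsub>G\<^esub> h) x = (\<rho> g \<otimes>\<^bsub>BijGroup M\<^esub> \<rho> h) x"
        using that bij mult ext[of "g \<otimes>\<^bsub>G\<^esub> h"]
        by (cases "x \<in> M") (auto simp: BijGroup_def compose_def extensional_def)
    qed
  qed
  then show ?thesis
    using iso by (simp add: isometric_action_def group_action_def group_hom_def group_hom_axioms_def group_BijGroup)
qed

lemma isometric_action_comp_hom:
  assumes "isometric_action G M d \<rho>" "f \<in> hom H G" "group H"
  shows "isometric_action H M d (\<rho> \<circ> f)"
proof -
  have "\<rho> \<in> hom G (BijGroup M)"
    using assms by (simp add: isometric_action_def group_action_def group_hom_def group_hom_axioms_def)
  then have "\<rho> \<circ> f \<in> hom H (BijGroup M)" by (rule hom_compose[OF assms(2)])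
  then show ?thesis
    using assms hom_in_carrier[OF assms(2)]
    by (auto simp: isometric_action_def group_action_def group_hom_def group_hom_axioms_def)
qed

lemma loxodromic_comp_hom:
  assumes "f \<in> hom H G" "group H" "group G" "h \<in> carrier H"
  shows "loxodromic H M d (\<rho> \<circ> f) h \<longleftrightarrow> loxodromic G M d \<rho> (f h)"
proof -
  interpret group_hom H G f using assms by (simp add: group_hom_def group_hom_axioms_def)
  show ?thesis using assms(4) by (simp add: loxodromic_def hom_int_pow)
qed

lemma property_NL_quotient:
  fixes G :: "('g, 'k) monoid_scheme" and H :: "('h, 'l) monoid_scheme"
  assumes NL: "property_NL G" and f: "f \<in> hom G H" "f ` carrier G = carrier H" and "group G" "group H"
  shows "property_NL H"
  unfolding property_NL_def
proof (intro allI impI notI)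
  fix M :: "('h \<times> real) set" and d \<rho>
  assume a: "hyperbolic_space M d \<and> isometric_action H M d \<rho>"
  assume "\<exists>h\<in>carrier H. loxodromic H M d \<rho> h"
  then obtain g where g: "g \<in> carrier G" "loxodromic H M d \<rho> (f g)" unfolding f(2)[symmetric] by auto
  then have "loxodromic G M d (\<rho> \<circ> f) g" by (simp add: loxodromic_comp_hom[OF f(1) assms(4,5)])
  then show False
    using property_NL_all_spaces[OF NL conjunct1[OF a] isometric_action_comp_hom[OF conjunct2[OF a] f(1) assms(4)]] g(1)
    by auto
qed


section \<open>The quasi-line of a quasimorphism\<close>

text \<open>
  Let \<open>p\<close> be a homogeneous quasimorphism with defect at most \<open>C\<close>. The functions \<open>f\<close> with
  \<open>\<bar>f (x y) - f x - p y\<bar> \<le> C\<close> for all \<open>x, y\<close> form a convex set that contains \<open>p\<close> and is invariant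
  under left translations. Convexity makes it geodesic for the supremum metric, and evaluation
  at the identity is an isometry to the real line up to an additive error of \<open>2 * C\<close>. An element \<open>g\<close>
  translates this quasi-line by \<open>- p g\<close> up to a bounded error.
\<close>

locale quasi_line = group G for G (structure) +
  fixes p :: "'a \<Rightarrow> real" and C :: real
  assumes p: "homogeneous_quasimorphism G p"
    and defect: "g \<in> carrier G \<Longrightarrow> h \<in> carrier G \<Longrightarrow> \<bar>p (g \<otimes> h) - p g - p h\<bar> \<le> C"
begin

definition line :: "('a \<Rightarrow> real) set" where
  "line = {f \<in> extensional (carrier G). \<forall>x\<in>carrier G. \<forall>y\<in>carrier G. \<bar>f (x \<otimes> y) - f x - p y\<bar> \<le> C}"

text \<open>
  The value 0 off \<open>line\<close> makes the distance nonnegative for all arguments, as \<open>Metric_space\<close> demands;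
  the supremum over an unbounded set would be arbitrary.
\<close>

definition sup_dist :: "('a \<Rightarrow> real) \<Rightarrow> ('a \<Rightarrow> real) \<Rightarrow> real" where
  "sup_dist f f' = (if f \<in> line \<and> f' \<in> line then SUP y\<in>carrier G. \<bar>f y - f' y\<bar> else 0)"

definition translate :: "'a \<Rightarrow> ('a \<Rightarrow> real) \<Rightarrow> 'a \<Rightarrow> real" where
  "translate g = (\<lambda>f\<in>line. \<lambda>x\<in>carrier G. f (inv g \<otimes> x))"

lemma C_nonneg: "C \<ge> 0"
  using defect[of \<one> \<one>] by simp

lemma lineD: "f \<in> line \<Longrightarrow> x \<in> carrier G \<Longrightarrow> y \<in> carrier G \<Longrightarrow> \<bar>f (x \<otimes> y) - f x - p y\<bar> \<le> C"
  by (simp add: line_def)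

lemma difference_le:
  assumes "f \<in> line" "f' \<in> line" "y \<in> carrier G"
  shows "\<bar>f y - f' y\<bar> \<le> \<bar>f \<one> - f' \<one>\<bar> + 2 * C"
  using lineD[OF assms(1) one_closed assms(3)] lineD[OF assms(2) one_closed assms(3)] assms(3) by simp

lemma difference_le_sup_dist:
  assumes "f \<in> line" "f' \<in> line" "y \<in> carrier G"
  shows "\<bar>f y - f' y\<bar> \<le> sup_dist f f'"
proof -
  have "bdd_above ((\<lambda>y. \<bar>f y - f' y\<bar>) ` carrier G)"
    using difference_le[OF assms(1,2)] by (intro bdd_aboveI2)
  then show ?thesis using assms by (auto simp: sup_dist_def intro: cSUP_upper)
qed

lemma sup_dist_leI:
  assumes "f \<in> line" "f' \<in> line" "\<And>y. y \<in> carrier G \<Longrightarrow> \<bar>f y - f' y\<bar> \<le> c"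
  shows "sup_dist f f' \<le> c"
proof -
  have "carrier G \<noteq> {}" using one_closed by blast
  then show ?thesis using assms by (auto simp: sup_dist_def intro: cSUP_least)
qed

lemma sup_dist_approx:
  assumes "f \<in> line" "f' \<in> line"
  shows "\<bar>f \<one> - f' \<one>\<bar> \<le> sup_dist f f'" "sup_dist f f' \<le> \<bar>f \<one> - f' \<one>\<bar> + 2 * C"
  using difference_le_sup_dist[OF assms one_closed] sup_dist_leI[OF assms difference_le[OF assms]] by auto

lemma Metric_space_line: "Metric_space line sup_dist"
proof
  show "0 \<le> sup_dist f f'" for f f'
  proof (cases "f \<in> line \<and> f' \<in> line")
    case True
    then show ?thesis using sup_dist_approx(1)[of f f'] by linarith
  qed (auto simp: sup_dist_def)
  show "sup_dist f f' = sup_dist f' f" for f f'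
    by (simp add: sup_dist_def abs_minus_commute)
  show "sup_dist f f' = 0 \<longleftrightarrow> f = f'" if "f \<in> line" "f' \<in> line" for f f'
  proof
    assume "sup_dist f f' = 0"
    then have "f y = f' y" if "y \<in> carrier G" for y
      using difference_le_sup_dist[OF \<open>f \<in> line\<close> \<open>f' \<in> line\<close> that] by simp
    then show "f = f'"
      using that by (intro extensionalityI[of f "carrier G" f']) (auto simp: line_def)
  next
    assume "f = f'"
    then show "sup_dist f f' = 0"
      using sup_dist_leI[of f f 0] sup_dist_approx(1)[of f f] that by simp
  qed
  show "sup_dist f f'' \<le> sup_dist f f' + sup_dist f' f''"
    if "f \<in> line" "f' \<in> line" "f'' \<in> line" for f f' f''
  proof (rule sup_dist_leI)
    fix y assume "y \<in> carrier G"
    then show "\<bar>f y - f'' y\<bar> \<le> sup_dist f f' + sup_dist f' f''"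
      using difference_le_sup_dist[OF that(1,2), of y] difference_le_sup_dist[OF that(2,3), of y] by linarith
  qed (use that in auto)
qed

lemma geodesic_space_line: "geodesic_space line sup_dist"
  unfolding geodesic_space_def
proof (intro ballI)
  interpret Metric_space line sup_dist by (rule Metric_space_line)
  fix f f' assume f: "f \<in> line" and f': "f' \<in> line"
  define L where "L = sup_dist f f'"
  define c where "c t = (\<lambda>x\<in>carrier G. f x + t / L * (f' x - f x))" for t
  have L: "L \<ge> 0" by (simp add: L_def)
  have frac: "0 \<le> t / L" "t / L \<le> 1" if "t \<in> {0..L}" for t
    using that L by (auto simp: divide_le_eq_1)
  have in_line: "c t \<in> line" if t: "t \<in> {0..L}" for t
    unfolding line_def
  proof (intro CollectI conjI ballI)
    show "c t \<in> extensional (carrier G)" by (simp add: c_def)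
    fix x y assume xy: "x \<in> carrier G" "y \<in> carrier G"
    let ?a = "f (x \<otimes> y) - f x - p y" and ?b = "f' (x \<otimes> y) - f' x - p y" and ?s = "t / L"
    have "c t (x \<otimes> y) - c t x - p y = (1 - ?s) * ?a + ?s * ?b"
      using xy by (simp add: c_def algebra_simps)
    also have "\<bar>\<dots>\<bar> \<le> (1 - ?s) * \<bar>?a\<bar> + ?s * \<bar>?b\<bar>"
      using frac[OF t] abs_triangle_ineq[of "(1 - ?s) * ?a" "?s * ?b"] by (simp only: abs_mult abs_of_nonneg)
    also have "\<dots> \<le> (1 - ?s) * C + ?s * C"
      using frac[OF t] lineD[OF f xy] lineD[OF f' xy] by (intro add_mono mult_left_mono) auto
    finally show "\<bar>c t (x \<otimes> y) - c t x - p y\<bar> \<le> C" by (simp add: algebra_simps)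
  qed
  have f_ext: "f \<in> extensional (carrier G)" "f' \<in> extensional (carrier G)"
    using f f' by (auto simp: line_def)
  have c0: "c 0 = f"
    using f_ext by (simp add: c_def extensional_restrict)
  have cL: "c L = f'"
  proof (cases "L = 0")
    case True
    then show ?thesis using c0 f f' by (simp add: L_def)
  next
    case False
    then show ?thesis using f_ext by (simp add: c_def extensional_restrict)
  qed
  have le: "sup_dist (c s) (c t) \<le> \<bar>s - t\<bar>" if s: "s \<in> {0..L}" and t: "t \<in> {0..L}" for s t
  proof (rule sup_dist_leI[OF in_line[OF s] in_line[OF t]])
    fix y assume y: "y \<in> carrier G"
    have "c s y - c t y = (s - t) / L * (f' y - f y)"
      using y by (simp add: c_def left_diff_distrib diff_divide_distrib)
    moreover have "\<bar>f' y - f y\<bar> \<le> L"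
      using difference_le_sup_dist[OF f f' y] by (simp add: L_def)
    ultimately have "\<bar>c s y - c t y\<bar> = \<bar>s - t\<bar> / L * \<bar>f' y - f y\<bar>" "\<bar>f' y - f y\<bar> \<le> L"
      using L by (simp_all add: abs_mult)
    then have "\<bar>c s y - c t y\<bar> \<le> \<bar>s - t\<bar> / L * L"
      using L by (simp only:) (intro mult_left_mono, auto)
    also have "\<dots> \<le> \<bar>s - t\<bar>" by simp
    finally show "\<bar>c s y - c t y\<bar> \<le> \<bar>s - t\<bar>" .
  qed
  \<comment> \<open>A path of length at most \<open>L\<close> between points at distance \<open>L\<close> cannot shorten distances.\<close>
  have "sup_dist (c s) (c t) = \<bar>s - t\<bar>" if s: "s \<in> {0..L}" and t: "t \<in> {0..L}" for s t
  proof -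
    have ends: "c 0 \<in> line" "c L \<in> line" "0 \<in> {0..L}" "L \<in> {0..L}" using L c0 cL f f' by auto
    have whole: "L = sup_dist (c 0) (c L)" unfolding c0 cL by (rule L_def)
    have "L \<le> sup_dist (c 0) (c s) + sup_dist (c s) (c t) + sup_dist (c t) (c L)"
      "L \<le> sup_dist (c 0) (c t) + sup_dist (c t) (c s) + sup_dist (c s) (c L)"
      using triangle[OF ends(1) in_line[OF s] ends(2)] triangle[OF in_line[OF s] in_line[OF t] ends(2)]
        triangle[OF ends(1) in_line[OF t] ends(2)] triangle[OF in_line[OF t] in_line[OF s] ends(2)]
      unfolding whole[symmetric] by linarith+
    moreover have "sup_dist (c 0) (c s) \<le> s" "sup_dist (c 0) (c t) \<le> t"
      "sup_dist (c s) (c L) \<le> L - s" "sup_dist (c t) (c L) \<le> L - t"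
      using le[OF ends(3) s] le[OF ends(3) t] le[OF s ends(4)] le[OF t ends(4)] s t by auto
    ultimately show ?thesis
      using le[OF s t] commute[of "c s" "c t"] by linarith
  qed
  then show "\<exists>c. geodesic_segment_from_to line sup_dist f f' c"
    unfolding geodesic_segment_from_to_def L_def[symmetric] using in_line c0 cL by blast
qed

lemma Gromov_hyperbolic_line: "Gromov_hyperbolic line sup_dist"
proof -
  have real_line: "\<bar>y - w\<bar> - \<bar>x - y\<bar> \<le> \<bar>z - w\<bar> - \<bar>x - z\<bar> \<or> \<bar>y - w\<bar> - \<bar>y - z\<bar> \<le> \<bar>x - w\<bar> - \<bar>x - z\<bar>"
    for w x y z :: real
    by (simp add: abs_if)
  have "Gromov_product sup_dist w x z
      \<ge> min (Gromov_product sup_dist w x y) (Gromov_product sup_dist w y z) - 3 * C"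
    if "w \<in> line" "x \<in> line" "y \<in> line" "z \<in> line" for w x y z
  proof -
    have "Gromov_product sup_dist w x y - 3 * C \<le> Gromov_product sup_dist w x z \<or>
        Gromov_product sup_dist w y z - 3 * C \<le> Gromov_product sup_dist w x z"
      using real_line[of "y \<one>" "w \<one>" "x \<one>" "z \<one>"] sup_dist_approx[OF that(2,1)] sup_dist_approx[OF that(3,1)]
        sup_dist_approx[OF that(4,1)] sup_dist_approx[OF that(2,3)] sup_dist_approx[OF that(3,4)]
        sup_dist_approx[OF that(2,4)]
      unfolding Gromov_product_def by argo
    then show ?thesis by linarith
  qed
  then show ?thesis
    unfolding Gromov_hyperbolic_def using C_nonneg by (intro exI[of _ "3 * C"]) auto
qed

lemma translate_closed:
  assumes g: "g \<in> carrier G" and f: "f \<in> line"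
  shows "translate g f \<in> line"
proof -
  have "\<bar>translate g f (x \<otimes> y) - translate g f x - p y\<bar> \<le> C" if "x \<in> carrier G" "y \<in> carrier G" for x y
    using lineD[OF f, of "inv g \<otimes> x" y] f g that by (simp add: translate_def m_assoc)
  then show ?thesis using f by (auto simp: line_def) (simp add: translate_def line_def)
qed

lemma isometric_action_line: "isometric_action G line sup_dist translate"
proof (rule isometric_actionI)
  show "sup_dist (translate g f) (translate g f') = sup_dist f f'"
    if g: "g \<in> carrier G" and f: "f \<in> line" and f': "f' \<in> line" for g f f'
  proof (rule antisym)
    show "sup_dist (translate g f) (translate g f') \<le> sup_dist f f'"
      using g f f' difference_le_sup_dist[OF f f']
      by (intro sup_dist_leI translate_closed) (auto simp: translate_def)
    show "sup_dist f f' \<le> sup_dist (translate g f) (translate g f')"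
    proof (rule sup_dist_leI[OF f f'])
      fix y assume "y \<in> carrier G"
      then show "\<bar>f y - f' y\<bar> \<le> sup_dist (translate g f) (translate g f')"
        using difference_le_sup_dist[OF translate_closed[OF g f] translate_closed[OF g f'], of "g \<otimes> y"] g f f'
        by (simp add: translate_def m_assoc[symmetric])
    qed
  qed
  show "translate (g \<otimes> h) f = translate g (translate h f)"
    if "g \<in> carrier G" "h \<in> carrier G" "f \<in> line" for g h f
    using that translate_closed[of h f] by (auto simp: translate_def inv_mult_group m_assoc fun_eq_iff)
  show "translate \<one> f = f" if "f \<in> line" for f
    using that by (auto simp: translate_def line_def extensional_def fun_eq_iff)
qed (simp_all add: translate_closed is_group, simp add: translate_def)

lemma loxodromic_line:
  assumes g: "g \<in> carrier G" and pg: "p g \<noteq> 0"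
  shows "loxodromic G line sup_dist translate g"
proof -
  define f0 where "f0 = restrict p (carrier G)"
  have f0: "f0 \<in> line" using defect by (simp add: f0_def line_def)
  have orbit: "translate (g [^] n) f0 \<in> line" "translate (g [^] n) f0 \<one> = - (of_int n * p g)" for n :: int
    using g f0 translate_closed homogeneous_quasimorphism_inv[OF p, of "g [^] n"]
      homogeneous_quasimorphism_int_pow[OF p g, of n]
    by (auto simp: translate_def) (simp add: f0_def)
  define K where "K = max 1 (max \<bar>p g\<bar> (1 / \<bar>p g\<bar>))"
  have K: "K \<ge> 1" "K \<ge> \<bar>p g\<bar>" "K \<ge> 1 / \<bar>p g\<bar>" by (auto simp: K_def)
  have "\<bar>real_of_int m - real_of_int n\<bar> / K - 2 * C \<le> sup_dist (translate (g [^] m) f0) (translate (g [^] n) f0) \<and>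
      sup_dist (translate (g [^] m) f0) (translate (g [^] n) f0) \<le> K * \<bar>real_of_int m - real_of_int n\<bar> + 2 * C"
    for m n :: int
  proof -
    let ?r = "\<bar>real_of_int m - real_of_int n\<bar>"
    have "translate (g [^] m) f0 \<one> - translate (g [^] n) f0 \<one> = (real_of_int n - real_of_int m) * p g"
      by (simp add: orbit algebra_simps)
    then have "\<bar>translate (g [^] m) f0 \<one> - translate (g [^] n) f0 \<one>\<bar> = ?r * \<bar>p g\<bar>"
      by (simp only: abs_mult abs_minus_commute)
    moreover have "?r * \<bar>p g\<bar> \<le> K * ?r"
      using K(2) by (simp add: mult.commute mult_right_mono)
    moreover have "?r / K \<le> ?r * \<bar>p g\<bar>"
    proof -
      have "1 / K \<le> \<bar>p g\<bar>" using K pg by (simp add: field_simps)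
      then have "?r * (1 / K) \<le> ?r * \<bar>p g\<bar>" by (intro mult_left_mono) auto
      then show ?thesis by simp
    qed
    ultimately show ?thesis
      using sup_dist_approx[OF orbit(1)[of m] orbit(1)[of n]] C_nonneg by linarith
  qed
  then show ?thesis
    unfolding loxodromic_def quasi_isometric_embedding_def
    using f0 orbit(1) K(1) C_nonneg by (intro bexI[of _ f0] conjI exI[of _ K] exI[of _ "2 * C"]) auto
qed

end

text \<open>
  An unbounded quasimorphism has a nonzero homogenization, whose quasi-line has a loxodromic element.
\<close>

theorem property_NL_imp_quasimorphisms_bounded:
  assumes G: "group G" and NL: "property_NL G" and q: "quasimorphism G q"
  shows "bounded (q ` carrier G)"
proof -
  interpret group G by (rule G)
  obtain p C where p: "homogeneous_quasimorphism G p" and C: "\<And>g. g \<in> carrier G \<Longrightarrow> \<bar>p g - q g\<bar> \<le> C"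
    using homogenization[OF q] by metis
  obtain E where E: "\<And>g h. g \<in> carrier G \<Longrightarrow> h \<in> carrier G \<Longrightarrow> \<bar>p (g \<otimes>\<^bsub>G\<^esub> h) - p g - p h\<bar> \<le> E"
    using p quasimorphismE unfolding homogeneous_quasimorphism_def by metis
  interpret quasi_line G p E by unfold_locales (fact p, rule E)
  have "hyperbolic_space line sup_dist"
    by (simp add: hyperbolic_space_def Metric_space_line geodesic_space_line Gromov_hyperbolic_line)
  then have "p g = 0" if "g \<in> carrier G" for g
    using property_NL_all_spaces[OF NL _ isometric_action_line] loxodromic_line that by blast
  then have "\<bar>q g\<bar> \<le> C" if "g \<in> carrier G" for g using C[OF that] that by simp
  then show ?thesis by (auto simp: bounded_iff)
qed


section \<open>Left-invariant hyperbolic metrics on groups\<close>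

lemma (in group) inv_mult_cancel_left [simp]:
  "x \<in> carrier G \<Longrightarrow> y \<in> carrier G \<Longrightarrow> inv x \<otimes> (x \<otimes> y) = y"
  by (simp add: m_assoc[symmetric])

lemma (in group) mult_inv_cancel_left [simp]:
  "x \<in> carrier G \<Longrightarrow> y \<in> carrier G \<Longrightarrow> x \<otimes> (inv x \<otimes> y) = y"
  by (simp add: m_assoc[symmetric])

text \<open>
  An isometric action on a hyperbolic space with a base point \<open>x\<close> induces the left-invariant
  pseudometric \<open>D a b = d (a x) (b x)\<close> on the group. It satisfies the four-point form of hyperbolicity, and it
  determines the loxodromic elements as those with positive stable translation length.
\<close>

locale hyperbolic_group_metric = group G for G (structure) +
  fixes D :: "'a \<Rightarrow> 'a \<Rightarrow> real" and \<delta> :: real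
  assumes D_self: "a \<in> carrier G \<Longrightarrow> D a a = 0"
    and D_sym: "a \<in> carrier G \<Longrightarrow> b \<in> carrier G \<Longrightarrow> D a b = D b a"
    and D_triangle: "a \<in> carrier G \<Longrightarrow> b \<in> carrier G \<Longrightarrow> c \<in> carrier G \<Longrightarrow> D a c \<le> D a b + D b c"
    and D_left: "c \<in> carrier G \<Longrightarrow> a \<in> carrier G \<Longrightarrow> b \<in> carrier G \<Longrightarrow> D (c \<otimes> a) (c \<otimes> b) = D a b"
    and \<delta>_nonneg: "\<delta> \<ge> 0"
    and four_point: "a \<in> carrier G \<Longrightarrow> b \<in> carrier G \<Longrightarrow> c \<in> carrier G \<Longrightarrow> e \<in> carrier G \<Longrightarrow>
      D a c + D b e \<le> max (D a b + D c e) (D a e + D b c) + 2 * \<delta>"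
begin

definition len :: "'a \<Rightarrow> real" where "len a = D \<one> a"

definition gromov_product :: "'a \<Rightarrow> 'a \<Rightarrow> 'a \<Rightarrow> real" where "gromov_product w a b = (D w a + D w b - D a b) / 2"

lemma D_eq_len: "a \<in> carrier G \<Longrightarrow> b \<in> carrier G \<Longrightarrow> D a b = len (inv a \<otimes> b)"
  using D_left[of "inv a" a b] by (simp add: len_def)

lemma D_mult_right: "a \<in> carrier G \<Longrightarrow> b \<in> carrier G \<Longrightarrow> D a (a \<otimes> b) = len b"
  using D_left[of a \<one> b] by (simp add: len_def)

lemma len_one [simp]: "len \<one> = 0"
  by (simp add: len_def D_self)

lemma len_inv: "a \<in> carrier G \<Longrightarrow> len (inv a) = len a"
  using D_mult_right[of "inv a" a] D_sym[of "inv a" \<one>] by (simp add: len_def)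

lemma len_mult: "a \<in> carrier G \<Longrightarrow> b \<in> carrier G \<Longrightarrow> len (a \<otimes> b) \<le> len a + len b"
  using D_triangle[of \<one> a "a \<otimes> b"] D_mult_right[of a b] by (simp add: len_def)

lemma len_nonneg: "a \<in> carrier G \<Longrightarrow> len a \<ge> 0"
  using len_mult[of "inv a" a] by (simp add: len_inv)

lemma len_nat_pow_le: "g \<in> carrier G \<Longrightarrow> len (g [^] (n::nat)) \<le> real n * len g"
proof (induction n)
  case (Suc n)
  then show ?case using len_mult[of "g [^] n" g] by (simp add: algebra_simps)
qed simp

lemma gromov_product_hyp:
  assumes "w \<in> carrier G" "a \<in> carrier G" "b \<in> carrier G" "c \<in> carrier G"
  shows "min (gromov_product w a b) (gromov_product w b c) - \<delta> \<le> gromov_product w a c"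
  using four_point[of a b c w] assms D_sym[of w a] D_sym[of w b] D_sym[of w c]
  unfolding gromov_product_def by (simp add: min_def max_def split: if_splits) argo+

lemma gromov_product_sym: "a \<in> carrier G \<Longrightarrow> b \<in> carrier G \<Longrightarrow> gromov_product w a b = gromov_product w b a"
  by (simp add: gromov_product_def D_sym)

lemma gromov_product_left:
  "c \<in> carrier G \<Longrightarrow> w \<in> carrier G \<Longrightarrow> a \<in> carrier G \<Longrightarrow> b \<in> carrier G \<Longrightarrow>
    gromov_product (c \<otimes> w) (c \<otimes> a) (c \<otimes> b) = gromov_product w a b"
  by (simp add: gromov_product_def D_left)

lemma gromov_product_change_base:
  assumes "w \<in> carrier G" "w' \<in> carrier G" "a \<in> carrier G" "b \<in> carrier G"
  shows "gromov_product w a b \<le> gromov_product w' a b + D w w'"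
proof -
  have "D w a \<le> D w w' + D w' a" "D w b \<le> D w w' + D w' b"
    using assms D_triangle by auto
  then show ?thesis unfolding gromov_product_def by argo
qed

lemma gromov_product_change_right:
  assumes "w \<in> carrier G" "a \<in> carrier G" "b \<in> carrier G" "b' \<in> carrier G"
  shows "gromov_product w a b \<le> gromov_product w a b' + D b b'"
proof -
  have "D w b \<le> D w b' + D b b'" "D a b' \<le> D a b + D b b'"
    using assms D_triangle[of w b' b] D_triangle[of a b b'] D_sym[of b b'] by auto
  then show ?thesis unfolding gromov_product_def by argo
qed

lemma gromov_product_left_one:
  assumes "c \<in> carrier G" "a \<in> carrier G" "b \<in> carrier G"
  shows "gromov_product \<one> a b - len c \<le> gromov_product \<one> (c \<otimes> a) (c \<otimes> b)"
  using gromov_product_change_base[of c \<one> "c \<otimes> a" "c \<otimes> b"] gromov_product_left[of c \<one> a b] D_sym[of c \<one>] assms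
  by (simp add: len_def)

lemma gromov_product_le: "w \<in> carrier G \<Longrightarrow> a \<in> carrier G \<Longrightarrow> b \<in> carrier G \<Longrightarrow> gromov_product w a b \<le> D w a"
  using D_triangle[of w a b] by (simp add: gromov_product_def)


subsection \<open>Stable translation length\<close>

definition translation_length :: "'a \<Rightarrow> real" where
  "translation_length g = (INF n\<in>{1::nat..}. len (g [^] n) / real n)"

lemma bdd_below_len_nat_pow:
  "g \<in> carrier G \<Longrightarrow> bdd_below ((\<lambda>n::nat. len (g [^] n) / real n) ` {1..})"
  by (rule bdd_belowI[of _ 0]) (auto simp: len_nonneg)

lemma translation_length_le:
  assumes "g \<in> carrier G"
  shows "real n * translation_length g \<le> len (g [^] n)"
proof (cases "n = 0")
  case False
  then have "translation_length g \<le> len (g [^] n) / real n"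
    unfolding translation_length_def using bdd_below_len_nat_pow[OF assms] by (intro cINF_lower) auto
  then show ?thesis using False by (simp add: field_simps)
qed simp

lemma le_translation_lengthI:
  assumes "\<And>n::nat. n \<ge> 1 \<Longrightarrow> real n * c \<le> len (g [^] n)"
  shows "c \<le> translation_length g"
  unfolding translation_length_def
  by (rule cINF_greatest) (use assms in \<open>auto simp: field_simps\<close>)

lemma translation_length_nonneg: "g \<in> carrier G \<Longrightarrow> translation_length g \<ge> 0"
  by (rule le_translation_lengthI) (simp add: len_nonneg)

lemma len_nat_pow_less:
  assumes "g \<in> carrier G" "c > translation_length g"
  obtains n :: nat where "n \<ge> 1" "len (g [^] n) < real n * c"
  using assms bdd_below_len_nat_pow[of g] that
  by (auto simp: translation_length_def cINF_less_iff field_simps)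

lemma translation_length_mult_commuting:
  assumes a: "a \<in> carrier G" and b: "b \<in> carrier G" and comm: "a \<otimes> b = b \<otimes> a"
  shows "translation_length (a \<otimes> b) \<le> translation_length a + translation_length b"
proof (rule ccontr)
  assume contra: "\<not> ?thesis"
  define e where "e = (translation_length (a \<otimes> b) - translation_length a - translation_length b) / 2"
  have e: "e > 0" using contra by (simp add: e_def)
  obtain m :: nat where m: "m \<ge> 1" "len (a [^] m) < real m * (translation_length a + e)"
    using len_nat_pow_less[OF a, of "translation_length a + e"] e by auto
  obtain n :: nat where n: "n \<ge> 1" "len (b [^] n) < real n * (translation_length b + e)"
    using len_nat_pow_less[OF b, of "translation_length b + e"] e by auto
  have "real (m * n) * translation_length (a \<otimes> b) \<le> len ((a \<otimes> b) [^] (m * n))"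
    using a b by (intro translation_length_le) auto
  also have "\<dots> \<le> len (a [^] (m * n)) + len (b [^] (m * n))"
    using a b len_mult by (simp add: pow_mult_distrib[OF comm])
  also have "\<dots> \<le> real n * len (a [^] m) + real m * len (b [^] n)"
    using len_nat_pow_le[of "a [^] m" n] len_nat_pow_le[of "b [^] n" m] a b
    by (simp add: nat_pow_pow mult.commute)
  also have "\<dots> < real n * (real m * (translation_length a + e)) + real m * (real n * (translation_length b + e))"
    using m n by (intro add_strict_mono mult_strict_left_mono) auto
  also have "\<dots> = real (m * n) * translation_length (a \<otimes> b)"
    by (simp add: e_def algebra_simps)
  finally show False by simp
qed

lemma translation_length_conj_le:
  assumes a: "a \<in> carrier G" and b: "b \<in> carrier G"
  shows "translation_length (b \<otimes> a \<otimes> inv b) \<le> translation_length a"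
proof (rule le_translation_lengthI)
  fix m :: nat
  have conj: "(b \<otimes> a \<otimes> inv b) [^] n = b \<otimes> a [^] n \<otimes> inv b" for n :: nat
  proof (induction n)
    case (Suc n)
    then show ?case using a b by (simp add: m_assoc)
  qed (use b in simp)
  show "real m * translation_length (b \<otimes> a \<otimes> inv b) \<le> len (a [^] m)"
  proof (rule le_of_linear_growth_le)
    fix k :: nat
    have "real (m * k) * translation_length (b \<otimes> a \<otimes> inv b) \<le> len (b \<otimes> a [^] (m * k) \<otimes> inv b)"
      using translation_length_le[of "b \<otimes> a \<otimes> inv b" "m * k"] a b by (simp add: conj)
    also have "\<dots> \<le> len b + len (a [^] (m * k)) + len (inv b)"
      using len_mult[of "b \<otimes> a [^] (m * k)" "inv b"] len_mult[of b "a [^] (m * k)"] a b by simp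
    also have "\<dots> \<le> real k * len (a [^] m) + 2 * len b"
      using len_nat_pow_le[of "a [^] m" k] a b by (simp add: nat_pow_pow len_inv)
    finally show "real k * (real m * translation_length (b \<otimes> a \<otimes> inv b)) \<le> real k * len (a [^] m) + 2 * len b"
      by (simp add: algebra_simps)
  qed
qed

lemma translation_length_conj:
  assumes a: "a \<in> carrier G" and b: "b \<in> carrier G"
  shows "translation_length (b \<otimes> a \<otimes> inv b) = translation_length a"
proof (rule antisym)
  have "inv b \<otimes> (b \<otimes> a \<otimes> inv b) \<otimes> inv (inv b) = a"
    using a b by (simp add: m_assoc)
  then show "translation_length a \<le> translation_length (b \<otimes> a \<otimes> inv b)"
    using translation_length_conj_le[of "b \<otimes> a \<otimes> inv b" "inv b"] a b by simp
qed (rule translation_length_conj_le[OF assms])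


subsection \<open>Straight elements\<close>

text \<open>
  The four-point inequality for \<open>1, g ^ n, g ^ (n + 1), g ^ (n + 2)\<close> propagates a definite increase
  of the displacement from one power to the next.
\<close>

lemma len_nat_pow_step:
  assumes g: "g \<in> carrier G" and \<eta>: "\<eta> > 0" and double: "len g + 2 * \<delta> + \<eta> \<le> len (g \<otimes> g)"
  shows "len (g [^] n) + \<eta> \<le> len (g [^] Suc n)"
proof (induction n)
  case 0
  show ?case using double len_mult[OF g g] \<delta>_nonneg g by simp
next
  case (Suc n)
  have "D (g [^] n) (g [^] Suc (Suc n)) = len (g \<otimes> g)"
    using D_mult_right[of "g [^] n" "g \<otimes> g"] g by (simp add: m_assoc)
  moreover have "D (g [^] Suc n) (g [^] Suc (Suc n)) = len g"
    using D_mult_right[of "g [^] Suc n" g] g by simp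
  moreover have "D (g [^] n) (g [^] Suc n) = len g"
    using D_mult_right[of "g [^] n" g] g by simp
  ultimately have "len (g [^] Suc n) + len (g \<otimes> g)
      \<le> max (len (g [^] n) + len g) (len (g [^] Suc (Suc n)) + len g) + 2 * \<delta>"
    using four_point[of \<one> "g [^] n" "g [^] Suc n" "g [^] Suc (Suc n)"] g by (simp add: len_def)
  then show ?case using Suc double \<eta> by (simp add: max_def split: if_splits)
qed

lemma len_nat_pow_ge:
  assumes "g \<in> carrier G" "\<eta> > 0" "len g + 2 * \<delta> + \<eta> \<le> len (g \<otimes> g)"
  shows "real n * \<eta> \<le> len (g [^] n)"
proof (induction n)
  case (Suc n)
  then show ?case using len_nat_pow_step[OF assms, of n] by (simp add: algebra_simps)
qed simp

lemma translation_length_pos_of_double: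
  assumes "g \<in> carrier G" "len g + 2 * \<delta> < len (g \<otimes> g)"
  shows "translation_length g > 0"
proof -
  have "len (g \<otimes> g) - len g - 2 * \<delta> \<le> translation_length g"
    by (rule le_translation_lengthI, rule len_nat_pow_ge) (use assms in auto)
  then show ?thesis using assms(2) by simp
qed

text \<open>
  A local condition on \<open>1, h, h\<^sup>2\<close> that controls all powers of \<open>h\<close>: they form a quasigeodesic whose backtracking is
  bounded by \<open>len h\<close>. The slack \<open>3 * \<delta>\<close> makes the increase of the length in each step larger than \<open>\<delta>\<close>.
\<close>

definition straight :: "'a \<Rightarrow> bool" where
  "straight h \<longleftrightarrow> h \<in> carrier G \<and> len h + 3 * \<delta> < len (h \<otimes> h)"

lemma straight_closed [simp]: "straight h \<Longrightarrow> h \<in> carrier G"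
  by (simp add: straight_def)

text \<open>
  Pick \<open>n\<close> with \<open>len (g ^ n) \<le> 3/2 * n * \<tau>\<close>, where \<open>\<tau>\<close> is the translation length. For
  multiples \<open>m\<close> of \<open>n\<close> the difference \<open>len (g ^ (2 * m)) - len (g ^ m)\<close> is at least
  \<open>m * \<tau> / 2\<close>, which is unbounded.
\<close>

lemma straight_power:
  assumes g: "g \<in> carrier G" and pos: "translation_length g > 0"
  obtains j :: nat where "j \<ge> 1" "straight (g [^] j)"
proof -
  obtain n :: nat where n: "n \<ge> 1" "len (g [^] n) < real n * (3 / 2 * translation_length g)"
    using len_nat_pow_less[OF g, of "3 / 2 * translation_length g"] pos by auto
  obtain k :: nat where k: "6 * \<delta> < real k * translation_length g"
    using reals_Archimedean3[OF pos] by blast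
  then have k1: "k \<ge> 1" using \<delta>_nonneg by (cases k) auto
  define j where "j = n * k"
  have "len (g [^] j) \<le> real k * len (g [^] n)"
    using len_nat_pow_le[of "g [^] n" k] g by (simp add: j_def nat_pow_pow)
  also have "\<dots> \<le> real k * (real n * (3 / 2 * translation_length g))"
    using n by (intro mult_left_mono) auto
  finally have "len (g [^] j) \<le> 3 / 2 * real j * translation_length g" by (simp add: j_def algebra_simps)
  moreover have "2 * real j * translation_length g \<le> len (g [^] j \<otimes> g [^] j)"
    using translation_length_le[OF g, of "j + j"] g by (simp add: nat_pow_mult algebra_simps)
  moreover have "6 * \<delta> < real j * translation_length g"
  proof -
    have "real k * translation_length g \<le> real j * translation_length g"
      using pos n(1) by (intro mult_right_mono) (auto simp: j_def simp flip: of_nat_mult)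
    then show ?thesis using k by linarith
  qed
  ultimately have "straight (g [^] j)" using g by (simp add: straight_def)
  moreover have "j \<ge> 1" using n k1 by (simp add: j_def)
  ultimately show thesis using that by blast
qed

lemma straight_inv:
  assumes "straight h" shows "straight (inv h)"
proof -
  have "inv h \<otimes> inv h = inv (h \<otimes> h)" using assms by (simp add: inv_mult_group)
  then show ?thesis using assms by (simp add: straight_def len_inv)
qed

text \<open>
  The four-point inequality for \<open>1, h ^ i, h ^ (i + 1), h ^ (i + 1 + k)\<close>: because passing from
  \<open>h ^ i\<close> to \<open>h ^ (i + 1)\<close> increases the length by more than \<open>\<delta>\<close>, the first alternative of
  the maximum is impossible.
\<close>

lemma straight_superadditive:
  assumes h: "straight h"
  shows "len (h [^] (i::nat)) + len (h [^] (k::nat)) \<le> len (h [^] (i + k)) + 2 * len h"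
proof -
  note [simp] = straight_closed[OF h]
  define \<eta> where "\<eta> = len (h \<otimes> h) - len h - 2 * \<delta>"
  have \<eta>: "\<eta> > \<delta>" "\<eta> > 0" "len h + 2 * \<delta> + \<eta> \<le> len (h \<otimes> h)"
    using h \<delta>_nonneg by (auto simp: \<eta>_def straight_def)
  note step = len_nat_pow_step[OF straight_closed[OF h] \<eta>(2,3)]
  have "D (h [^] i) (h [^] (i + Suc k)) = len (h [^] Suc k)"
    using D_mult_right[of "h [^] i" "h [^] Suc k"] nat_pow_mult[of h i "Suc k"] by (simp del: nat_pow_Suc)
  moreover have "D (h [^] Suc i) (h [^] (i + Suc k)) = len (h [^] k)"
    using D_mult_right[of "h [^] Suc i" "h [^] k"] nat_pow_mult[of h "Suc i" k] by (simp del: nat_pow_Suc)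
  moreover have "D (h [^] i) (h [^] Suc i) = len h"
    using D_mult_right[of "h [^] i" h] by simp
  ultimately have "len (h [^] Suc i) + len (h [^] Suc k)
      \<le> max (len (h [^] i) + len (h [^] k)) (len (h [^] (i + Suc k)) + len h) + 2 * \<delta>"
    using four_point[of \<one> "h [^] i" "h [^] Suc i" "h [^] (i + Suc k)"]
    by (simp add: len_def del: nat_pow_Suc)
  then have "len (h [^] i) + len (h [^] k) \<le> len (h [^] (i + Suc k)) + len h"
    using step[of i] step[of k] \<eta>(1) by (simp add: max_def split: if_splits del: nat_pow_Suc)
  moreover have "len (h [^] (i + Suc k)) \<le> len (h [^] (i + k)) + len h"
    using len_mult[of "h [^] (i + k)" h] by simp
  ultimately show ?thesis by simp
qed


subsection \<open>The stabilizer of an end\<close>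

text \<open>
  Two sequences in the group converge to the same point of the Gromov boundary.
\<close>

definition same_end :: "(nat \<Rightarrow> 'a) \<Rightarrow> (nat \<Rightarrow> 'a) \<Rightarrow> bool" where
  "same_end u v \<longleftrightarrow> (\<forall>R. \<exists>N. \<forall>i\<ge>N. \<forall>j\<ge>N. R \<le> gromov_product \<one> (u i) (v j))"

lemma same_end_sym:
  assumes "\<And>i. u i \<in> carrier G" "\<And>i. v i \<in> carrier G" "same_end u v"
  shows "same_end v u"
  using assms gromov_product_sym unfolding same_end_def by metis

lemma same_end_trans:
  assumes u: "\<And>i. u i \<in> carrier G" and v: "\<And>i. v i \<in> carrier G" and w: "\<And>i. w i \<in> carrier G"
    and uv: "same_end u v" and vw: "same_end v w"
  shows "same_end u w"
  unfolding same_end_def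
proof
  fix R
  obtain M where M: "\<And>i j. i \<ge> M \<Longrightarrow> j \<ge> M \<Longrightarrow> R + \<delta> \<le> gromov_product \<one> (u i) (v j)"
    using uv unfolding same_end_def by blast
  obtain N where N: "\<And>i j. i \<ge> N \<Longrightarrow> j \<ge> N \<Longrightarrow> R + \<delta> \<le> gromov_product \<one> (v i) (w j)"
    using vw unfolding same_end_def by blast
  have "R \<le> gromov_product \<one> (u i) (w j)" if "i \<ge> max M N" "j \<ge> max M N" for i j
    using M[of i "max M N"] N[of "max M N" j] gromov_product_hyp[of \<one> "u i" "v (max M N)" "w j"] that u v w
    by simp
  then show "\<exists>N::nat. \<forall>i\<ge>N. \<forall>j\<ge>N. R \<le> gromov_product \<one> (u i) (w j)" by blast
qed

lemma same_end_left:
  assumes u: "\<And>i. u i \<in> carrier G" and v: "\<And>i. v i \<in> carrier G" and c: "c \<in> carrier G"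
    and uv: "same_end u v"
  shows "same_end (\<lambda>i. c \<otimes> u i) (\<lambda>i. c \<otimes> v i)"
  unfolding same_end_def
proof
  fix R
  obtain N where "\<And>i j. i \<ge> N \<Longrightarrow> j \<ge> N \<Longrightarrow> R + len c \<le> gromov_product \<one> (u i) (v j)"
    using uv unfolding same_end_def by blast
  then have "R \<le> gromov_product \<one> (c \<otimes> u i) (c \<otimes> v j)" if "i \<ge> N" "j \<ge> N" for i j
    using gromov_product_left_one[OF c u v, of i j] that by (smt (verit))
  then show "\<exists>N::nat. \<forall>i\<ge>N. \<forall>j\<ge>N. R \<le> gromov_product \<one> (c \<otimes> u i) (c \<otimes> v j)" by blast
qed

lemma same_end_straight:
  assumes h: "straight h"
  shows "same_end (\<lambda>i::nat. h [^] i) (\<lambda>i::nat. h [^] i)"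
  unfolding same_end_def
proof
  fix R
  note [simp] = straight_closed[OF h]
  define \<eta> where "\<eta> = len (h \<otimes> h) - len h - 2 * \<delta>"
  have \<eta>: "\<eta> > 0" "len h + 2 * \<delta> + \<eta> \<le> len (h \<otimes> h)"
    using h \<delta>_nonneg by (auto simp: \<eta>_def straight_def)
  note step = len_nat_pow_step[OF straight_closed[OF h] \<eta>]
  have mono: "len (h [^] i) \<le> len (h [^] j)" if "i \<le> j" for i j :: nat
    using lift_Suc_mono_le[of "\<lambda>i. len (h [^] i)" i j] step \<eta>(1) that by (smt (verit))
  have ordered: "len (h [^] i) / 2 \<le> gromov_product \<one> (h [^] i) (h [^] j)" if "i \<le> j" for i j :: nat
  proof -
    have "D (h [^] i) (h [^] j) = len (h [^] (j - i))"
      using D_mult_right[of "h [^] i" "h [^] (j - i)"] that by (simp add: nat_pow_mult)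
    then show ?thesis using mono[of "j - i" j] by (simp add: gromov_product_def len_def)
  qed
  obtain N :: nat where N: "2 * R < real N * \<eta>" using reals_Archimedean3[OF \<eta>(1)] by blast
  then have N2: "2 * R \<le> len (h [^] N)"
    using len_nat_pow_ge[OF straight_closed[OF h] \<eta>, of N] by linarith
  have "R \<le> gromov_product \<one> (h [^] i) (h [^] j)" if "i \<ge> N" "j \<ge> N" for i j :: nat
  proof (cases "i \<le> j")
    case True
    then show ?thesis using ordered[OF True] mono[OF that(1)] N2 by simp
  next
    case False
    then show ?thesis
      using ordered[of j i] mono[OF that(2)] N2 gromov_product_sym[of "h [^] i" "h [^] j" \<one>] by simp
  qed
  then show "\<exists>N::nat. \<forall>i\<ge>N. \<forall>j\<ge>N. R \<le> gromov_product \<one> (h [^] i) (h [^] j)" by blast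
qed

text \<open>
  The elements that fix the attracting end of \<open>h\<close>, the limit of the positive powers of \<open>h\<close>.
\<close>

definition end_stabilizer :: "'a \<Rightarrow> 'a set" where
  "end_stabilizer h = {c \<in> carrier G. same_end (\<lambda>i. c \<otimes> h [^] i) (\<lambda>i::nat. h [^] i)}"

lemma subgroup_end_stabilizer:
  assumes h: "straight h"
  shows "subgroup (end_stabilizer h) G"
proof (rule subgroupI)
  note [simp] = straight_closed[OF h]
  show "end_stabilizer h \<subseteq> carrier G" by (auto simp: end_stabilizer_def)
  have "\<one> \<in> end_stabilizer h" using same_end_straight[OF h] by (simp add: end_stabilizer_def)
  then show "end_stabilizer h \<noteq> {}" by blast
  show "inv c \<in> end_stabilizer h" if "c \<in> end_stabilizer h" for c
  proof -
    have c: "c \<in> carrier G" "same_end (\<lambda>i. c \<otimes> h [^] i) (\<lambda>i::nat. h [^] i)"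
      using that by (auto simp: end_stabilizer_def)
    have "same_end (\<lambda>i. inv c \<otimes> (c \<otimes> h [^] i)) (\<lambda>i. inv c \<otimes> h [^] i)"
      by (rule same_end_left) (use c in auto)
    then have "same_end (\<lambda>i::nat. h [^] i) (\<lambda>i. inv c \<otimes> h [^] i)"
      using c(1) by (simp add: m_assoc[symmetric])
    then show ?thesis using c same_end_sym by (simp add: end_stabilizer_def)
  qed
  show "b \<otimes> c \<in> end_stabilizer h" if "b \<in> end_stabilizer h" "c \<in> end_stabilizer h" for b c
  proof -
    have bc: "b \<in> carrier G" "same_end (\<lambda>i. b \<otimes> h [^] i) (\<lambda>i::nat. h [^] i)"
      "c \<in> carrier G" "same_end (\<lambda>i. c \<otimes> h [^] i) (\<lambda>i::nat. h [^] i)"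
      using that by (auto simp: end_stabilizer_def)
    have "same_end (\<lambda>i. b \<otimes> (c \<otimes> h [^] i)) (\<lambda>i. b \<otimes> h [^] i)"
      by (rule same_end_left) (use bc in auto)
    then have "same_end (\<lambda>i. b \<otimes> (c \<otimes> h [^] i)) (\<lambda>i::nat. h [^] i)"
      by (rule same_end_trans[rotated 3]) (use bc in auto)
    then show ?thesis using bc by (simp add: end_stabilizer_def m_assoc)
  qed
qed

lemma end_stabilizer_commuting:
  assumes h: "straight h" and c: "c \<in> carrier G" and comm: "c \<otimes> h = h \<otimes> c"
  shows "c \<in> end_stabilizer h"
proof -
  note [simp] = straight_closed[OF h]
  have "same_end (\<lambda>i. c \<otimes> h [^] i) (\<lambda>i::nat. h [^] i)"
    unfolding same_end_def
  proof
    fix R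
    obtain N :: nat where N: "\<And>i j. i \<ge> N \<Longrightarrow> j \<ge> N \<Longrightarrow> R + len c \<le> gromov_product \<one> (h [^] i) (h [^] j)"
      using same_end_straight[OF h] unfolding same_end_def by blast
    have "R \<le> gromov_product \<one> (c \<otimes> h [^] i) (h [^] j)" if "i \<ge> N" "j \<ge> N" for i j :: nat
    proof -
      have "c \<otimes> h [^] i = h [^] i \<otimes> c"
      proof (induction i)
        case (Suc i)
        have "c \<otimes> h [^] Suc i = h [^] i \<otimes> (c \<otimes> h)" using Suc c by (simp add: m_assoc[symmetric])
        also have "\<dots> = h [^] Suc i \<otimes> c" using c comm by (simp add: m_assoc)
        finally show ?case .
      qed (use c in simp)
      then have "D (h [^] i) (c \<otimes> h [^] i) = len c" using c by (simp add: D_mult_right)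
      then show ?thesis
        using gromov_product_change_right[of \<one> "h [^] j" "h [^] i" "c \<otimes> h [^] i"] N[OF that] c
          gromov_product_sym[of "h [^] i" "h [^] j" \<one>] gromov_product_sym[of "c \<otimes> h [^] i" "h [^] j" \<one>] by simp
    qed
    then show "\<exists>N::nat. \<forall>i\<ge>N. \<forall>j\<ge>N. R \<le> gromov_product \<one> (c \<otimes> h [^] i) (h [^] j)" by blast
  qed
  then show ?thesis using c by (simp add: end_stabilizer_def)
qed

text \<open>
  If \<open>c\<close> moves the end of \<open>h\<close>, the two quasigeodesic rays \<open>h ^ i\<close> and \<open>c h ^ i\<close> diverge:
  a large product \<open>(c h ^ i | h ^ i)\<close> at one late index would be inherited by all late pairs.
\<close>

lemma not_end_stabilizerE:
  assumes h: "straight h" and c: "c \<in> carrier G" "c \<notin> end_stabilizer h"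
  obtains R where "\<And>i::nat. gromov_product \<one> (c \<otimes> h [^] i) (h [^] i) \<le> R"
proof -
  note [simp] = straight_closed[OF h]
  obtain R where R: "\<And>N::nat. \<exists>i\<ge>N. \<exists>j\<ge>N. gromov_product \<one> (c \<otimes> h [^] i) (h [^] j) < R"
    using c unfolding end_stabilizer_def same_end_def not_le[symmetric] by blast
  obtain N :: nat where N: "\<And>i j. i \<ge> N \<Longrightarrow> j \<ge> N \<Longrightarrow> R + 2 * \<delta> + len c \<le> gromov_product \<one> (h [^] i) (h [^] j)"
    using same_end_straight[OF h] unfolding same_end_def by blast
  obtain i' j' where ij: "i' \<ge> N" "j' \<ge> N" "gromov_product \<one> (c \<otimes> h [^] i') (h [^] j') < R"
    using R[of N] by blast
  have "gromov_product \<one> (c \<otimes> h [^] i) (h [^] i) \<le> max (R + 2 * \<delta>) (len c + real N * len h)" for i :: nat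
  proof (cases "i \<ge> N")
    case True
    have "R + 2 * \<delta> \<le> gromov_product \<one> (c \<otimes> h [^] i') (c \<otimes> h [^] i)"
      using gromov_product_left_one[of c "h [^] i'" "h [^] i"] N[OF ij(1) True] c by simp
    moreover have "R + 2 * \<delta> \<le> gromov_product \<one> (h [^] i) (h [^] j')"
      using N[OF True ij(2)] len_nonneg[OF c(1)] by simp
    ultimately show ?thesis
      using gromov_product_hyp[of \<one> "c \<otimes> h [^] i'" "c \<otimes> h [^] i" "h [^] j'"]
        gromov_product_hyp[of \<one> "c \<otimes> h [^] i" "h [^] i" "h [^] j'"] ij(3) c \<delta>_nonneg
      by (simp add: min_def max_def split: if_splits)
  next
    case False
    have "gromov_product \<one> (c \<otimes> h [^] i) (h [^] i) \<le> len (c \<otimes> h [^] i)"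
      using gromov_product_le[of \<one> "c \<otimes> h [^] i" "h [^] i"] c by (simp add: len_def)
    also have "\<dots> \<le> len c + real i * len h"
      using len_mult[of c "h [^] i"] len_nat_pow_le[of h i] c by simp
    also have "\<dots> \<le> len c + real N * len h"
      using False len_nonneg[of h] by (intro add_left_mono mult_right_mono) auto
    finally show ?thesis by simp
  qed
  then show thesis using that by blast
qed


subsection \<open>Busemann quasimorphisms\<close>

text \<open>
  Seen from two points far out in the same direction, the difference of the distances to \<open>y\<close> and
  \<open>z\<close> is the same up to \<open>2 * \<delta>\<close>: in the four-point inequality the alternative that contains
  \<open>D u v\<close> cannot hold.
\<close>

lemma horofunction_difference:
  assumes y: "y \<in> carrier G" and z: "z \<in> carrier G" and u: "u \<in> carrier G" and v: "v \<in> carrier G"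
    and far: "gromov_product \<one> u v > len y + len z + \<delta>"
  shows "\<bar>(D y u - D z u) - (D y v - D z v)\<bar> \<le> 2 * \<delta>"
proof -
  have one_sided: "D y u + D z v \<le> D y v + D z u + 2 * \<delta>"
    if "u \<in> carrier G" "v \<in> carrier G" "gromov_product \<one> u v > len y + len z + \<delta>" for u v
  proof -
    have "D y u + D z v \<le> max (D y z + D u v) (D y v + D z u) + 2 * \<delta>"
      using four_point[of y z u v] that y z by simp
    moreover have "len u \<le> len y + D y u" "len v \<le> len z + D z v" "D y z \<le> len y + len z"
      using D_triangle[of \<one> y u] D_triangle[of \<one> z v] D_triangle[of y \<one> z] D_sym[of y \<one>] that y z
      by (auto simp: len_def)
    ultimately show ?thesis using that(3) by (auto simp: gromov_product_def len_def[symmetric] max_def split: if_splits)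
  qed
  show ?thesis
    using one_sided[OF u v far] one_sided[OF v u] far gromov_product_sym[OF u v, of \<one>] by linarith
qed

text \<open>
  For \<open>c\<close> in the stabilizer of the end of \<open>h\<close> let \<open>q c\<close> be the value of the Busemann function of
  this end at \<open>c\<close>, that is, \<open>D c (h ^ m) - D 1 (h ^ m)\<close> for large \<open>m\<close>; it exists up to an error
  of \<open>2 * \<delta>\<close>. Writing \<open>D (b c) (h ^ m) - D 1 (h ^ m)\<close> as
  \<open>(D c (b\<inverse> h ^ m) - D 1 (b\<inverse> h ^ m)) + (D b (h ^ m) - D 1 (h ^ m))\<close> shows that \<open>q\<close> is a
  quasimorphism, because \<open>b\<inverse> h ^ m\<close> tends to the same end.
\<close>

lemma busemann_quasimorphism:
  assumes h: "straight h"
  obtains q where "quasimorphism (G\<lparr>carrier := end_stabilizer h\<rparr>) q"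
    "\<And>c. c \<in> carrier G \<Longrightarrow> \<exists>N. \<forall>m\<ge>N. \<bar>D c (h [^] (m::nat)) - len (h [^] m) - q c\<bar> \<le> 2 * \<delta>"
proof -
  note [simp] = straight_closed[OF h]
  let ?P = "end_stabilizer h"
  have "\<exists>r N. \<forall>m\<ge>N. \<bar>D c (h [^] (m::nat)) - len (h [^] m) - r\<bar> \<le> 2 * \<delta>" if c: "c \<in> carrier G" for c
  proof -
    obtain N :: nat where N: "\<And>i j. i \<ge> N \<Longrightarrow> j \<ge> N \<Longrightarrow> len c + \<delta> + 1 \<le> gromov_product \<one> (h [^] i) (h [^] j)"
      using same_end_straight[OF h] unfolding same_end_def by blast
    have "\<bar>D c (h [^] m) - len (h [^] m) - (D c (h [^] N) - len (h [^] N))\<bar> \<le> 2 * \<delta>" if "m \<ge> N" for m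
      using horofunction_difference[of c \<one> "h [^] m" "h [^] N"] N[OF that order_refl] c
      by (simp add: len_def[symmetric])
    then show ?thesis by blast
  qed
  then obtain q where q: "\<And>c. c \<in> carrier G \<Longrightarrow>
      \<exists>N. \<forall>m\<ge>N. \<bar>D c (h [^] (m::nat)) - len (h [^] m) - q c\<bar> \<le> 2 * \<delta>"
    by metis
  have "quasimorphism (G\<lparr>carrier := ?P\<rparr>) q"
  proof (rule quasimorphismI[where D = "8 * \<delta>"], simp_all)
    fix b c assume b: "b \<in> ?P" and c: "c \<in> ?P"
    have [simp]: "b \<in> carrier G" "c \<in> carrier G" using b c by (auto simp: end_stabilizer_def)
    have "inv b \<in> ?P"
      using subgroup.m_inv_closed[OF subgroup_end_stabilizer[OF h] b] by simp
    then obtain K :: nat where K: "\<And>i j. i \<ge> K \<Longrightarrow> j \<ge> K \<Longrightarrow>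
        len c + \<delta> + 1 \<le> gromov_product \<one> (inv b \<otimes> h [^] i) (h [^] j)"
      unfolding end_stabilizer_def same_end_def by blast
    obtain L :: nat where L: "\<And>m. m \<ge> L \<Longrightarrow> \<bar>D b (h [^] m) - len (h [^] m) - q b\<bar> \<le> 2 * \<delta>"
      using q[of b] by auto
    obtain M :: nat where M: "\<And>m. m \<ge> M \<Longrightarrow> \<bar>D c (h [^] m) - len (h [^] m) - q c\<bar> \<le> 2 * \<delta>"
      using q[of c] by auto
    obtain N :: nat where N: "\<And>m. m \<ge> N \<Longrightarrow> \<bar>D (b \<otimes> c) (h [^] m) - len (h [^] m) - q (b \<otimes> c)\<bar> \<le> 2 * \<delta>"
      using q[of "b \<otimes> c"] by auto
    define m where "m = max (max K L) (max M N)"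
    have m: "m \<ge> K" "m \<ge> L" "m \<ge> M" "m \<ge> N" by (auto simp: m_def)
    have "D (b \<otimes> c) (h [^] m) = D c (inv b \<otimes> h [^] m)" "D b (h [^] m) = len (inv b \<otimes> h [^] m)"
      using D_left[of b c "inv b \<otimes> h [^] m"] D_mult_right[of b "inv b \<otimes> h [^] m"] by simp_all
    moreover have "\<bar>(D c (inv b \<otimes> h [^] m) - len (inv b \<otimes> h [^] m)) - (D c (h [^] m) - len (h [^] m))\<bar> \<le> 2 * \<delta>"
      using horofunction_difference[of c \<one> "inv b \<otimes> h [^] m" "h [^] m"] K[OF m(1) m(1)]
      by (simp add: len_def[symmetric])
    ultimately show "\<bar>q (b \<otimes> c) - q b - q c\<bar> \<le> 8 * \<delta>"
      using L[OF m(2)] M[OF m(3)] N[OF m(4)] by linarith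
  qed
  then show thesis using that q by blast
qed

text \<open>
  The homogenization \<open>p\<close> of the Busemann quasimorphism \<open>q\<close> satisfies \<open>\<bar>p c\<bar> \<le> \<tau> c\<close> because
  \<open>\<bar>q c\<bar> \<le> len c + 2 * \<delta>\<close>. Conversely, let \<open>c ^ j\<close> be straight and \<open>y = c ^ (j * n)\<close>. The Gromov
  product of \<open>y\<close> and \<open>y\<inverse>\<close> is bounded independently of \<open>n\<close>, so one of the two, say \<open>y\<close>, has a
  bounded Gromov product with the far points \<open>h ^ m\<close>. This means that \<open>y\<close> is reached by moving away from
  the end of \<open>h\<close>: the length of \<open>y\<close> exceeds its Busemann value \<open>q y\<close> by a bounded amount only.
\<close>

theorem busemann_homogeneous_quasimorphism:
  assumes h: "straight h"
  obtains p where "homogeneous_quasimorphism (G\<lparr>carrier := end_stabilizer h\<rparr>) p"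
    "\<And>c. c \<in> end_stabilizer h \<Longrightarrow> \<bar>p c\<bar> = translation_length c"
proof -
  note [simp] = straight_closed[OF h]
  let ?P = "end_stabilizer h"
  interpret P: subgroup ?P G by (rule subgroup_end_stabilizer[OF h])
  interpret PG: group "G\<lparr>carrier := ?P\<rparr>" by (rule P.subgroup_is_group) (rule is_group)
  obtain q where qm: "quasimorphism (G\<lparr>carrier := ?P\<rparr>) q" and
    q: "\<And>c. c \<in> carrier G \<Longrightarrow> \<exists>N. \<forall>m\<ge>N. \<bar>D c (h [^] (m::nat)) - len (h [^] m) - q c\<bar> \<le> 2 * \<delta>"
    using busemann_quasimorphism[OF h] by metis
  obtain p C where p: "homogeneous_quasimorphism (G\<lparr>carrier := ?P\<rparr>) p"
    and C: "\<And>c. c \<in> ?P \<Longrightarrow> \<bar>p c - q c\<bar> \<le> C"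
    using PG.homogenization[OF qm] by auto
  have pow_P: "c [^] n \<in> ?P" if "c \<in> ?P" for c and n :: nat
    using that by (induction n) auto
  have p_pow: "p (c [^] n) = real n * p c" if "c \<in> ?P" for c n
    using homogeneous_quasimorphism_nat_pow[OF p, of c n] that by (simp flip: nat_pow_consistent)
  have p_inv: "p (inv c) = - p c" if "c \<in> ?P" for c
    using PG.homogeneous_quasimorphism_inv[OF p, of c] that by (simp add: m_inv_consistent[OF P.subgroup_axioms])
  have q_le: "\<bar>q c\<bar> \<le> len c + 2 * \<delta>" if c: "c \<in> carrier G" for c
  proof -
    obtain N where "\<bar>D c (h [^] (N::nat)) - len (h [^] N) - q c\<bar> \<le> 2 * \<delta>" using q[OF c] by blast
    moreover have "\<bar>D c (h [^] N) - len (h [^] N)\<bar> \<le> len c"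
      using D_triangle[of c \<one> "h [^] N"] D_triangle[of \<one> c "h [^] N"] D_sym[of c \<one>] c
      by (simp add: len_def)
    ultimately show ?thesis by linarith
  qed
  have p_le: "\<bar>p c\<bar> \<le> len c" if c: "c \<in> ?P" for c
  proof (rule le_of_linear_growth_le)
    fix n :: nat
    have "real n * \<bar>p c\<bar> = \<bar>p (c [^] n)\<bar>" using p_pow[OF c] by (simp add: abs_mult)
    also have "\<dots> \<le> len (c [^] n) + (2 * \<delta> + C)"
      using C[OF pow_P[OF c], of n] q_le[of "c [^] n"] c by simp
    also have "\<dots> \<le> real n * len c + (2 * \<delta> + C)" using len_nat_pow_le[of c n] c by simp
    finally show "real n * \<bar>p c\<bar> \<le> real n * len c + (2 * \<delta> + C)" .
  qed
  have "\<bar>p c\<bar> = translation_length c" if c: "c \<in> ?P" for c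
  proof (rule antisym)
    show "\<bar>p c\<bar> \<le> translation_length c"
    proof (rule le_translation_lengthI)
      fix n :: nat
      show "real n * \<bar>p c\<bar> \<le> len (c [^] n)"
        using p_le[OF pow_P[OF c], of n] p_pow[OF c, of n] by (simp add: abs_mult)
    qed
    show "translation_length c \<le> \<bar>p c\<bar>"
    proof (cases "translation_length c = 0")
      case False
      then have "translation_length c > 0" using translation_length_nonneg[of c] c by simp
      then obtain j :: nat where j: "j \<ge> 1" "straight (c [^] j)" using straight_power[of c] c by auto
      let ?g = "c [^] j"
      have g: "?g \<in> ?P" by (rule pow_P[OF c])
      define E where "E = 2 * len ?g + 4 * \<delta> + C"
      have len_le: "len (?g [^] n) \<le> real n * \<bar>p ?g\<bar> + E" for n :: nat
      proof -
        let ?y = "?g [^] n"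
        have y: "?y \<in> ?P" "inv ?y \<in> ?P" using pow_P[OF g] by auto
        then have [simp]: "?y \<in> carrier G" by simp
        have opp: "gromov_product \<one> (inv ?y) ?y \<le> len ?g"
          using straight_superadditive[OF j(2), of n n] len_inv[of ?y] nat_pow_mult[of ?g n n]
            straight_closed[OF j(2)]
          by (simp add: gromov_product_def D_eq_len len_def[symmetric])
        obtain M :: nat where M: "\<And>m. m \<ge> M \<Longrightarrow> \<bar>D ?y (h [^] m) - len (h [^] m) - q ?y\<bar> \<le> 2 * \<delta>"
          using q[of ?y] by auto
        obtain N :: nat where N: "\<And>m. m \<ge> N \<Longrightarrow> \<bar>D (inv ?y) (h [^] m) - len (h [^] m) - q (inv ?y)\<bar> \<le> 2 * \<delta>"
          using q[of "inv ?y"] by auto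
        let ?u = "h [^] max M N"
        have "min (gromov_product \<one> (inv ?y) ?u) (gromov_product \<one> ?u ?y) - \<delta> \<le> gromov_product \<one> (inv ?y) ?y"
          by (rule gromov_product_hyp) auto
        then have "gromov_product \<one> (inv ?y) ?u \<le> len ?g + \<delta> \<or> gromov_product \<one> ?y ?u \<le> len ?g + \<delta>"
          using opp gromov_product_sym[of ?y ?u \<one>] by (auto simp: min_def split: if_splits)
        then have "len ?y \<le> q (inv ?y) + 2 * len ?g + 4 * \<delta> \<or> len ?y \<le> q ?y + 2 * len ?g + 4 * \<delta>"
          using M[of "max M N"] N[of "max M N"] len_inv[of ?y]
          by (auto simp: gromov_product_def len_def[symmetric])
        then have "len ?y \<le> \<bar>p ?y\<bar> + E"
          using C[OF y(1)] C[OF y(2)] p_inv[OF y(1)] by (auto simp: E_def)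
        then show ?thesis using p_pow[OF g, of n] by (simp add: abs_mult)
      qed
      have "real j * translation_length c \<le> real j * \<bar>p c\<bar>"
      proof (rule le_of_linear_growth_le)
        fix n :: nat
        show "real n * (real j * translation_length c) \<le> real n * (real j * \<bar>p c\<bar>) + E"
          using len_le[of n] translation_length_le[of c "j * n"] p_pow[OF c, of j] c
          by (simp add: nat_pow_pow abs_mult algebra_simps)
      qed
      then show ?thesis using j(1) by simp
    qed simp
  qed
  then show thesis using that p by blast
qed


subsection \<open>Normal subgroups without loxodromic elements\<close>

text \<open>
  The hypotheses say that the broken path \<open>p, q, r, s\<close> hardly backtracks at its vertices; if the
  middle edge is long, there is no backtracking at \<open>r\<close> when seen from \<open>p\<close> either.
\<close>

lemma gromov_product_chain:
  assumes "p \<in> carrier G" "q \<in> carrier G" "r \<in> carrier G" "s \<in> carrier G"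
    and "gromov_product q p r \<le> S'" "gromov_product r q s \<le> S" "D q r > S + S' + \<delta>"
  shows "gromov_product r p s \<le> S + \<delta>"
proof -
  have "gromov_product r q p = D q r - gromov_product q p r"
    using assms(1-4) D_sym[of p q] D_sym[of q r] D_sym[of p r] by (simp add: gromov_product_def field_simps)
  then show ?thesis
    using gromov_product_hyp[of r q p s] assms by (simp add: min_def split: if_splits)
qed

text \<open>
  If \<open>n\<close> moves both ends of \<open>h\<close>, then for \<open>u = h ^ k\<close> and \<open>v = n u\<inverse> n\<inverse>\<close> the
  attracting end of each of the two differs from the repelling end of the other. Hence the broken path
  \<open>1, u, u v, u v u, u v u v\<close> backtracks at its vertices by an amount that does not depend on \<open>k\<close>. For large \<open>k\<close> the
  length of \<open>(u v)\<^sup>2\<close> is therefore twice that of \<open>u v\<close> up to a bounded error.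
\<close>

lemma loxodromic_commutator:
  assumes h: "straight h" and n: "n \<in> carrier G"
    and n1: "n \<notin> end_stabilizer h" and n2: "n \<notin> end_stabilizer (inv h)"
  obtains u where "u \<in> carrier G" "translation_length (u \<otimes> n \<otimes> inv u \<otimes> inv n) > 0"
proof -
  note [simp] = straight_closed[OF h] n
  obtain R1 where R1: "\<And>i::nat. gromov_product \<one> (n \<otimes> h [^] i) (h [^] i) \<le> R1"
    using not_end_stabilizerE[OF h n n1] by metis
  obtain R2 where R2: "\<And>i::nat. gromov_product \<one> (n \<otimes> inv h [^] i) (inv h [^] i) \<le> R2"
    using not_end_stabilizerE[OF straight_inv[OF h] n n2] by metis
  define S where "S = max (max R1 R2) 0 + len n"
  have S: "S \<ge> 0" using len_nonneg[OF n] by (simp add: S_def)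
  obtain k :: nat where k: "4 * S + 5 * \<delta> + 2 * len n + 1 < real k * translation_length h"
    using reals_Archimedean3[OF translation_length_pos_of_double[of h]] h \<delta>_nonneg
    by (auto simp: straight_def)
  define u where "u = h [^] k"
  have [simp]: "u \<in> carrier G" by (simp add: u_def)
  have len_u: "len u > 4 * S + 5 * \<delta> + 2 * len n + 1"
    using k translation_length_le[of h k] by (simp add: u_def)
  define v where "v = n \<otimes> inv u \<otimes> inv n"
  have [simp]: "v \<in> carrier G" by (simp add: v_def)
  have inv_v: "inv v = n \<otimes> u \<otimes> inv n" by (simp add: v_def inv_mult_group m_assoc)
  have len_v: "len v \<ge> len u - 2 * len n"
  proof -
    have "u = inv n \<otimes> inv v \<otimes> n" by (simp add: inv_v m_assoc)
    then have "len u \<le> len (inv n) + len (inv v) + len n"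
      using len_mult[of "inv n \<otimes> inv v" n] len_mult[of "inv n" "inv v"] by simp
    then show ?thesis by (simp add: len_inv)
  qed
  have dist_v: "D (n \<otimes> inv u) v = len n" "D (n \<otimes> u) (inv v) = len n"
    unfolding inv_v unfolding v_def
    using D_mult_right[of "n \<otimes> inv u" "inv n"] D_mult_right[of "n \<otimes> u" "inv n"]
    by (simp_all add: len_inv)
  have angle1: "gromov_product \<one> (inv u) v \<le> S"
    using gromov_product_change_right[of \<one> "inv u" v "n \<otimes> inv u"] R2[of k] dist_v(1) D_sym[of "n \<otimes> inv u" v]
      gromov_product_sym[of "inv u" "n \<otimes> inv u" \<one>]
    by (simp add: S_def u_def nat_pow_inv)
  have angle2: "gromov_product \<one> (inv v) u \<le> S"
    using gromov_product_change_right[of \<one> u "inv v" "n \<otimes> u"] R1[of k] dist_v(2) D_sym[of "n \<otimes> u" "inv v"]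
      gromov_product_sym[of u "n \<otimes> u" \<one>] gromov_product_sym[of u "inv v" \<one>]
    by (simp add: S_def u_def)
  let ?p2 = "u \<otimes> v" and ?p3 = "u \<otimes> v \<otimes> u" and ?p4 = "u \<otimes> v \<otimes> u \<otimes> v"
  have turn1: "gromov_product u \<one> ?p2 \<le> S"
    using gromov_product_left[of u \<one> "inv u" v] angle1 by simp
  have turn2: "gromov_product ?p2 u ?p3 \<le> S"
    using gromov_product_left[of ?p2 \<one> "inv v" u] angle2 by (simp add: m_assoc)
  have turn3: "gromov_product ?p3 ?p2 ?p4 \<le> S"
    using gromov_product_left[of ?p3 \<one> "inv u" v] angle1 by (simp add: m_assoc)
  have edges: "D u ?p2 = len v" "D ?p2 ?p3 = len u" "D ?p3 ?p4 = len v"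
    by (simp_all add: D_mult_right)
  have far2: "gromov_product ?p2 \<one> ?p3 \<le> S + \<delta>"
    by (rule gromov_product_chain[OF _ _ _ _ turn1 turn2]) (use edges len_v len_u S \<delta>_nonneg len_nonneg[OF n] in auto)
  have far3: "gromov_product ?p3 \<one> ?p4 \<le> S + \<delta>"
    by (rule gromov_product_chain[OF _ _ _ _ far2 turn3]) (use edges len_u S \<delta>_nonneg len_nonneg[OF n] in auto)
  have "len ?p4 = len ?p2 + len u + len v - 2 * gromov_product ?p2 \<one> ?p3 - 2 * gromov_product ?p3 \<one> ?p4"
    using edges D_sym[of ?p2 \<one>] D_sym[of ?p3 \<one>] by (simp add: gromov_product_def len_def field_simps)
  then have "len ?p2 + 2 * \<delta> < len ?p4"
    using far2 far3 len_u len_v S \<delta>_nonneg len_nonneg[OF n] by linarith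
  then have "translation_length ?p2 > 0"
    by (intro translation_length_pos_of_double) (simp_all add: m_assoc)
  moreover have "?p2 = u \<otimes> n \<otimes> inv u \<otimes> inv n" by (simp add: v_def m_assoc)
  ultimately show thesis using that[of u] by simp
qed

text \<open>
  If no element of a normal subgroup \<open>N\<close> is loxodromic, then every element of \<open>N\<close> fixes one of the two
  ends of a straight power of \<open>g\<close>, because otherwise some commutator, which is again in \<open>N\<close>, would be loxodromic. As a group
  is not the union of two proper subgroups, all of \<open>N\<close> fixes the same end. The corresponding homogeneous
  Busemann quasimorphism vanishes on \<open>N\<close> and therefore takes the same value at \<open>g\<close> and \<open>g n\<close>.
\<close>

theorem translation_length_mod_normal:
  assumes N: "N \<lhd> G" and elliptic: "\<And>n. n \<in> N \<Longrightarrow> translation_length n = 0"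
    and g: "g \<in> carrier G" and pos: "translation_length g > 0" and n: "n \<in> N"
  shows "translation_length (g \<otimes> n) = translation_length g"
proof -
  interpret N: normal N G by (rule N)
  obtain j :: nat where h: "straight (g [^] j)" using straight_power[OF g pos] by blast
  let ?h = "g [^] j"
  have h': "straight (inv ?h)" by (rule straight_inv[OF h])
  have fix_one: "m \<in> end_stabilizer ?h \<or> m \<in> end_stabilizer (inv ?h)" if m: "m \<in> N" for m
  proof (rule ccontr)
    assume "\<not> ?thesis"
    then obtain u where u: "u \<in> carrier G" "translation_length (u \<otimes> m \<otimes> inv u \<otimes> inv m) > 0"
      using loxodromic_commutator[OF h, of m] m by auto
    moreover have "u \<otimes> m \<otimes> inv u \<otimes> inv m \<in> N"
      using N.inv_op_closed2[OF u(1) m] m by auto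
    ultimately show False using elliptic by simp
  qed
  have "N \<subseteq> end_stabilizer ?h \<or> N \<subseteq> end_stabilizer (inv ?h)"
  proof (rule ccontr)
    assume "\<not> ?thesis"
    then obtain a b where a: "a \<in> N" "a \<notin> end_stabilizer ?h" and b: "b \<in> N" "b \<notin> end_stabilizer (inv ?h)"
      by blast
    have a': "a \<in> end_stabilizer (inv ?h)" and b': "b \<in> end_stabilizer ?h"
      using fix_one[OF a(1)] fix_one[OF b(1)] a b by auto
    interpret P: subgroup "end_stabilizer ?h" G by (rule subgroup_end_stabilizer[OF h])
    interpret P': subgroup "end_stabilizer (inv ?h)" G by (rule subgroup_end_stabilizer[OF h'])
    have "a \<otimes> b \<in> end_stabilizer ?h \<or> a \<otimes> b \<in> end_stabilizer (inv ?h)"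
      using fix_one a b by simp
    then show False
    proof
      assume "a \<otimes> b \<in> end_stabilizer ?h"
      from P.m_closed[OF this P.m_inv_closed[OF b']] show False
        using a b by (simp add: m_assoc)
    next
      assume "a \<otimes> b \<in> end_stabilizer (inv ?h)"
      from P'.m_closed[OF P'.m_inv_closed[OF a'] this] show False
        using a b by simp
    qed
  qed
  then obtain h0 where h0: "straight h0" and NP: "N \<subseteq> end_stabilizer h0" and "h0 = ?h \<or> h0 = inv ?h"
    using h h' by blast
  moreover have comm: "g \<otimes> ?h = ?h \<otimes> g"
    using nat_pow_Suc2[OF g, of j] by simp
  moreover have "g \<otimes> inv ?h = inv ?h \<otimes> g"
  proof -
    have "inv ?h \<otimes> (?h \<otimes> g) \<otimes> inv ?h = inv ?h \<otimes> (g \<otimes> ?h) \<otimes> inv ?h" by (simp only: comm)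
    then show ?thesis using g by (simp add: m_assoc)
  qed
  ultimately have "g \<otimes> h0 = h0 \<otimes> g" by auto
  then have gP: "g \<in> end_stabilizer h0" by (rule end_stabilizer_commuting[OF h0 g])
  interpret P: subgroup "end_stabilizer h0" G by (rule subgroup_end_stabilizer[OF h0])
  obtain p where p: "homogeneous_quasimorphism (G\<lparr>carrier := end_stabilizer h0\<rparr>) p"
    and abs: "\<And>c. c \<in> end_stabilizer h0 \<Longrightarrow> \<bar>p c\<bar> = translation_length c"
    using busemann_homogeneous_quasimorphism[OF h0] by metis
  obtain C where C: "\<And>a b. a \<in> end_stabilizer h0 \<Longrightarrow> b \<in> end_stabilizer h0 \<Longrightarrow> \<bar>p (a \<otimes> b) - p a - p b\<bar> \<le> C"
  proof -
    have "quasimorphism (G\<lparr>carrier := end_stabilizer h0\<rparr>) p"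
      using p by (simp add: homogeneous_quasimorphism_def)
    from quasimorphismE[OF this] show thesis using that by auto
  qed
  have p_pow: "p (c [^] k) = real k * p c" if "c \<in> end_stabilizer h0" for c k
    using homogeneous_quasimorphism_nat_pow[OF p, of c k] that by (simp flip: nat_pow_consistent)
  have gn: "g \<otimes> n \<in> end_stabilizer h0" using gP n NP by blast
  have "\<bar>p (g \<otimes> n) - p g\<bar> \<le> 0"
  proof (rule le_of_linear_growth_le)
    fix k :: nat
    have "\<exists>m\<in>N. (g \<otimes> n) [^] k = g [^] k \<otimes> m"
    proof (induction k)
      case (Suc k)
      then obtain m where m: "m \<in> N" "(g \<otimes> n) [^] k = g [^] k \<otimes> m" by blast
      have "(g \<otimes> n) [^] Suc k = g [^] Suc k \<otimes> ((inv g \<otimes> m \<otimes> g) \<otimes> n)"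
        using m g n by (simp add: m_assoc)
      moreover have "(inv g \<otimes> m \<otimes> g) \<otimes> n \<in> N"
        using N.inv_op_closed1[OF g m(1)] n by simp
      ultimately show ?case by blast
    qed (use n in \<open>auto intro: bexI[of _ \<one>]\<close>)
    then obtain m where m: "m \<in> N" "(g \<otimes> n) [^] k = g [^] k \<otimes> m" by blast
    have "p m = 0" using abs[of m] elliptic[OF m(1)] m(1) NP by auto
    moreover have "g [^] k \<in> end_stabilizer h0" using gP by (induction k) auto
    ultimately have "\<bar>real k * p (g \<otimes> n) - real k * p g\<bar> \<le> C"
      using C[of "g [^] k" m] p_pow[OF gn, of k] p_pow[OF gP, of k] m NP by auto
    moreover have "real k * \<bar>p (g \<otimes> n) - p g\<bar> = \<bar>real k * p (g \<otimes> n) - real k * p g\<bar>"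
      by (simp add: abs_mult flip: right_diff_distrib)
    ultimately show "real k * \<bar>p (g \<otimes> n) - p g\<bar> \<le> real k * 0 + C" by simp
  qed
  then show ?thesis using abs[OF gn] abs[OF gP] by simp
qed

end


section \<open>From actions to left-invariant metrics\<close>

lemma (in hyperbolic_group_metric) D_int_pow:
  assumes g: "g \<in> carrier G"
  shows "D (g [^] (m::int)) (g [^] n) = len (g [^] nat \<bar>m - n\<bar>)"
proof -
  have ordered: "D (g [^] m) (g [^] n) = len (g [^] nat (n - m))" if le: "m \<le> n" for m n :: int
  proof -
    obtain k where k: "n = m + int k" using zle_iff_zadd[of m n] le by auto
    then have "g [^] n = g [^] m \<otimes> g [^] k"
      using int_pow_mult[OF g, of m "int k"] by (simp add: int_pow_int)
    then show ?thesis using D_mult_right[of "g [^] m" "g [^] k"] g k by simp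
  qed
  show ?thesis
    using ordered[of m n] ordered[of n m] D_sym[of "g [^] m" "g [^] n"] g by (cases "m \<le> n") auto
qed

lemma hyperbolic_group_metric_of_action:
  assumes hyp: "hyperbolic_space M d" and act: "isometric_action G M d \<rho>" and x: "x \<in> M"
  obtains \<delta> where "hyperbolic_group_metric G (\<lambda>a b. d (\<rho> a x) (\<rho> b x)) \<delta>"
proof -
  interpret Metric_space M d using hyp by (simp add: hyperbolic_space_def)
  interpret act: group_action G M \<rho> using act by (simp add: isometric_action_def)
  interpret group G using act.group_hom by (simp add: group_hom_def)
  obtain \<delta> where \<delta>: "\<delta> \<ge> 0" and gromov: "\<And>w x y z. w \<in> M \<Longrightarrow> x \<in> M \<Longrightarrow> y \<in> M \<Longrightarrow> z \<in> M \<Longrightarrow>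
      Gromov_product d w x z \<ge> min (Gromov_product d w x y) (Gromov_product d w y z) - \<delta>"
    using hyp unfolding hyperbolic_space_def Gromov_hyperbolic_def by blast
  have in_M: "\<rho> g x \<in> M" if "g \<in> carrier G" for g
    using act.element_image[OF that x] by simp
  have "hyperbolic_group_metric G (\<lambda>a b. d (\<rho> a x) (\<rho> b x)) \<delta>"
  proof unfold_locales
    show "d (\<rho> a x) (\<rho> a x) = 0" if "a \<in> carrier G" for a using in_M[OF that] by simp
    show "d (\<rho> a x) (\<rho> b x) = d (\<rho> b x) (\<rho> a x)" for a b by (rule commute)
    show "d (\<rho> a x) (\<rho> c x) \<le> d (\<rho> a x) (\<rho> b x) + d (\<rho> b x) (\<rho> c x)"
      if "a \<in> carrier G" "b \<in> carrier G" "c \<in> carrier G" for a b c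
      using that by (intro triangle in_M)
    show "d (\<rho> (c \<otimes>\<^bsub>G\<^esub> a) x) (\<rho> (c \<otimes>\<^bsub>G\<^esub> b) x) = d (\<rho> a x) (\<rho> b x)"
      if "c \<in> carrier G" "a \<in> carrier G" "b \<in> carrier G" for c a b
      using act act.composition_rule[OF x] in_M that by (simp add: isometric_action_def)
    show "d (\<rho> a x) (\<rho> c x) + d (\<rho> b x) (\<rho> e x)
        \<le> max (d (\<rho> a x) (\<rho> b x) + d (\<rho> c x) (\<rho> e x)) (d (\<rho> a x) (\<rho> e x) + d (\<rho> b x) (\<rho> c x)) + 2 * \<delta>"
      if "a \<in> carrier G" "b \<in> carrier G" "c \<in> carrier G" "e \<in> carrier G" for a b c e
    proof -
      let ?p = "Gromov_product d (\<rho> e x)"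
      have "?p (\<rho> a x) (\<rho> b x) - \<delta> \<le> ?p (\<rho> a x) (\<rho> c x) \<or> ?p (\<rho> b x) (\<rho> c x) - \<delta> \<le> ?p (\<rho> a x) (\<rho> c x)"
        using gromov[OF in_M[OF that(4)] in_M[OF that(1)] in_M[OF that(2)] in_M[OF that(3)]] by linarith
      then have "d (\<rho> a x) (\<rho> c x) + d (\<rho> b x) (\<rho> e x) \<le> d (\<rho> b x) (\<rho> c x) + d (\<rho> a x) (\<rho> e x) + 2 * \<delta> \<or>
          d (\<rho> a x) (\<rho> c x) + d (\<rho> b x) (\<rho> e x) \<le> d (\<rho> a x) (\<rho> b x) + d (\<rho> c x) (\<rho> e x) + 2 * \<delta>"
        unfolding Gromov_product_def by argo
      then show ?thesis by linarith
    qed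
  qed (rule \<delta>)
  then show thesis using that by blast
qed

text \<open>
  A quasi-isometric embedding gives \<open>len (g ^ n) \<ge> n / K - C\<close> only; comparing \<open>len (g ^ (n * k))\<close> with
  \<open>k * len (g ^ n)\<close> for large \<open>k\<close> removes the constant \<open>C\<close>.
\<close>

lemma translation_length_pos_iff:
  fixes G (structure)
  assumes hgm: "hyperbolic_group_metric G (\<lambda>a b. d (\<rho> a x) (\<rho> b x)) \<delta>"
    and act: "isometric_action G M d \<rho>" and x: "x \<in> M" and g: "g \<in> carrier G"
  shows "hyperbolic_group_metric.translation_length G (\<lambda>a b. d (\<rho> a x) (\<rho> b x)) g > 0 \<longleftrightarrow>
    quasi_isometric_embedding UNIV (\<lambda>m n. \<bar>real_of_int m - real_of_int n\<bar>) M d (\<lambda>n::int. \<rho> (g [^]\<^bsub>G\<^esub> n) x)"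
    (is "_ \<longleftrightarrow> ?qie")
proof -
  interpret hyperbolic_group_metric G "\<lambda>a b. d (\<rho> a x) (\<rho> b x)" \<delta> by (rule hgm)
  let ?\<tau> = "translation_length g"
  have len: "d (\<rho> (g [^] m) x) (\<rho> (g [^] n) x) = len (g [^] nat \<bar>m - n\<bar>)" for m n :: int
    using D_int_pow[OF g] .
  have "\<rho> a x \<in> M" if "a \<in> carrier G" for a
    using act x that group_action.element_image by (fastforce simp: isometric_action_def)
  then have orbit: "range (\<lambda>n::int. \<rho> (g [^] n) x) \<subseteq> M" using g by auto
  show ?thesis
  proof
    assume pos: "?\<tau> > 0"
    define K where "K = max 1 (max (len g) (1 / ?\<tau>))"
    have K: "K \<ge> 1" "K \<ge> len g" "K \<ge> 1 / ?\<tau>" by (auto simp: K_def)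
    have "\<bar>real_of_int m - real_of_int n\<bar> / K - 0 \<le> d (\<rho> (g [^] m) x) (\<rho> (g [^] n) x) \<and>
        d (\<rho> (g [^] m) x) (\<rho> (g [^] n) x) \<le> K * \<bar>real_of_int m - real_of_int n\<bar> + 0" for m n :: int
    proof -
      define k where "k = nat \<bar>m - n\<bar>"
      have k: "\<bar>real_of_int m - real_of_int n\<bar> = real k" by (simp add: k_def)
      have "1 / K \<le> ?\<tau>" using K pos by (simp add: field_simps)
      then have "real k * (1 / K) \<le> real k * ?\<tau>" by (intro mult_left_mono) auto
      then have "real k / K \<le> len (g [^] k)"
        using translation_length_le[OF g, of k] by simp
      moreover have "len (g [^] k) \<le> K * real k"
        using len_nat_pow_le[OF g, of k] mult_left_mono[OF K(2), of "real k"] by (simp add: mult.commute)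
      ultimately show ?thesis unfolding k len k_def[symmetric] by simp
    qed
    then show ?qie
      unfolding quasi_isometric_embedding_def using orbit K(1) by (intro conjI exI[of _ K] exI[of _ 0]) auto
  next
    assume ?qie
    then obtain K C where K: "K \<ge> 1" and qie: "\<And>m n::int. \<bar>real_of_int m - real_of_int n\<bar> / K - C \<le> d (\<rho> (g [^] m) x) (\<rho> (g [^] n) x)"
      unfolding quasi_isometric_embedding_def by blast
    have lower: "real n / K - C \<le> len (g [^] n)" for n :: nat
      using qie[of "int n" 0] len[of "int n" 0] by simp
    have "1 / K \<le> ?\<tau>"
    proof (rule le_translation_lengthI)
      fix n :: nat
      show "real n * (1 / K) \<le> len (g [^] n)"
      proof (rule le_of_linear_growth_le)
        fix k :: nat
        have "real (n * k) / K - C \<le> len (g [^] (n * k))" by (rule lower)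
        also have "\<dots> \<le> real k * len (g [^] n)"
          using len_nat_pow_le[of "g [^] n" k] g by (simp add: nat_pow_pow)
        finally show "real k * (real n * (1 / K)) \<le> real k * len (g [^] n) + C" by (simp add: mult.commute)
      qed
    qed
    then show "?\<tau> > 0" using K by (smt (verit) zero_less_divide_1_iff)
  qed
qed




section \<open>Factors of a permutational product\<close>

locale permutational_product_group =
  fixes B :: "'b monoid" and S :: "'s set" and \<phi> :: "'b \<Rightarrow> 's \<Rightarrow> 's" and A :: "'s \<Rightarrow> 'a monoid"
  assumes action: "group_action B S \<phi>" and family: "invariant_family B S \<phi> A"
begin

sublocale act: group_action B S \<phi> by (rule action)
sublocale B: group B using act.group_hom by (simp add: group_hom_def)

abbreviation W :: "(('s \<Rightarrow> 'a) \<times> 'b) monoid" where "W \<equiv> permutational_product B S \<phi> A"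

sublocale W: group W by (rule group_permutational_product[OF action family])

lemma group_factor: "s \<in> S \<Longrightarrow> group (A s)"
  using family by (simp add: invariant_family_def)

lemma A_invariant: "b \<in> carrier B \<Longrightarrow> s \<in> S \<Longrightarrow> A (\<phi> b s) = A s"
  using family by (simp add: invariant_family_def)

lemma \<phi>_closed: "b \<in> carrier B \<Longrightarrow> s \<in> S \<Longrightarrow> \<phi> b s \<in> S"
  using act.element_image by blast

lemma \<phi>_one: "s \<in> S \<Longrightarrow> \<phi> \<one>\<^bsub>B\<^esub> s = s"
  using act.id_eq_one by (metis restrict_apply')

lemma \<phi>_inv: "b \<in> carrier B \<Longrightarrow> s \<in> S \<Longrightarrow> \<phi> (inv\<^bsub>B\<^esub> b) (\<phi> b s) = s"
  "b \<in> carrier B \<Longrightarrow> s \<in> S \<Longrightarrow> \<phi> b (\<phi> (inv\<^bsub>B\<^esub> b) s) = s"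
  using act.composition_rule[of s "inv\<^bsub>B\<^esub> b" b] act.composition_rule[of s b "inv\<^bsub>B\<^esub> b"] \<phi>_one
  by simp_all

lemma carrier_W: "(n, b) \<in> carrier W \<longleftrightarrow> b \<in> carrier B \<and> n \<in> extensional S \<and>
    (\<forall>s\<in>S. n s \<in> carrier (A s)) \<and> finite {s \<in> S. n s \<noteq> \<one>\<^bsub>A s\<^esub>}"
  using carrier_sum_group[of S A] group_factor
  by (auto simp: permutational_product_def semidirect_product_def PiE_iff)

lemma mult_W: "(n, b) \<otimes>\<^bsub>W\<^esub> (n', b') = ((\<lambda>s\<in>S. n s \<otimes>\<^bsub>A s\<^esub> n' (\<phi> (inv\<^bsub>B\<^esub> b) s)), b \<otimes>\<^bsub>B\<^esub> b')"
  by (auto simp: permutational_product_def semidirect_product_def permute_factors_def fun_eq_iff)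

lemma one_W: "\<one>\<^bsub>W\<^esub> = ((\<lambda>s\<in>S. \<one>\<^bsub>A s\<^esub>), \<one>\<^bsub>B\<^esub>)"
  by (simp add: permutational_product_def semidirect_product_def)

definition tuple :: "'s set \<Rightarrow> ('s \<Rightarrow> 'a) \<Rightarrow> ('s \<Rightarrow> 'a) \<times> 'b" where
  "tuple F x = ((\<lambda>s\<in>S. if s \<in> F then x s else \<one>\<^bsub>A s\<^esub>), \<one>\<^bsub>B\<^esub>)"

definition factor :: "'s \<Rightarrow> 'a \<Rightarrow> ('s \<Rightarrow> 'a) \<times> 'b" where
  "factor s a = tuple {s} (\<lambda>_. a)"

definition of_B :: "'b \<Rightarrow> ('s \<Rightarrow> 'a) \<times> 'b" where
  "of_B b = ((\<lambda>s\<in>S. \<one>\<^bsub>A s\<^esub>), b)"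

lemma one_closed_A [simp]: "s \<in> S \<Longrightarrow> \<one>\<^bsub>A s\<^esub> \<in> carrier (A s)"
  using group_factor[of s] by (simp add: group.is_monoid)

lemma l_one_A [simp]: "s \<in> S \<Longrightarrow> a \<in> carrier (A s) \<Longrightarrow> \<one>\<^bsub>A s\<^esub> \<otimes>\<^bsub>A s\<^esub> a = a"
  using group_factor[of s] by (simp add: group.is_monoid)

lemma r_one_A [simp]: "s \<in> S \<Longrightarrow> a \<in> carrier (A s) \<Longrightarrow> a \<otimes>\<^bsub>A s\<^esub> \<one>\<^bsub>A s\<^esub> = a"
  using group_factor[of s] by (simp add: group.is_monoid)

lemma tuple_closed:
  assumes "finite F" "\<And>s. s \<in> F \<inter> S \<Longrightarrow> x s \<in> carrier (A s)"
  shows "tuple F x \<in> carrier W"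
proof -
  have "{s \<in> S. (\<lambda>s\<in>S. if s \<in> F then x s else \<one>\<^bsub>A s\<^esub>) s \<noteq> \<one>\<^bsub>A s\<^esub>} \<subseteq> F" by auto
  then show ?thesis
    using assms by (auto simp: tuple_def carrier_W intro: finite_subset)
qed

lemma factor_closed: "s \<in> S \<Longrightarrow> a \<in> carrier (A s) \<Longrightarrow> factor s a \<in> carrier W"
  unfolding factor_def by (rule tuple_closed) auto

lemma tuple_mult:
  assumes "\<And>s. s \<in> F \<Longrightarrow> x s \<in> carrier (A s)" "\<And>s. s \<in> F \<Longrightarrow> y s \<in> carrier (A s)"
  shows "tuple F x \<otimes>\<^bsub>W\<^esub> tuple F y = tuple F (\<lambda>s. x s \<otimes>\<^bsub>A s\<^esub> y s)"
  using assms by (auto simp: tuple_def mult_W fun_eq_iff \<phi>_one)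

lemma tuple_empty: "tuple {} x = \<one>\<^bsub>W\<^esub>"
  by (simp add: tuple_def one_W)

lemma tuple_insert:
  assumes "r \<notin> F" "r \<in> S" "F \<subseteq> S" "\<And>s. s \<in> insert r F \<Longrightarrow> x s \<in> carrier (A s)"
  shows "tuple (insert r F) x = factor r (x r) \<otimes>\<^bsub>W\<^esub> tuple F x"
    and "factor r (x r) \<otimes>\<^bsub>W\<^esub> tuple F x = tuple F x \<otimes>\<^bsub>W\<^esub> factor r (x r)"
  using assms by (auto simp: tuple_def factor_def mult_W fun_eq_iff \<phi>_one)

lemma factor_hom:
  assumes s: "s \<in> S"
  shows "factor s \<in> hom (A s) W"
proof (rule homI)
  show "factor s a \<in> carrier W" if "a \<in> carrier (A s)" for a
    using s that by (rule factor_closed)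
  show "factor s (a \<otimes>\<^bsub>A s\<^esub> b) = factor s a \<otimes>\<^bsub>W\<^esub> factor s b"
    if "a \<in> carrier (A s)" "b \<in> carrier (A s)" for a b
    using tuple_mult[of "{s}" "\<lambda>_. a" "\<lambda>_. b"] that by (auto simp: factor_def tuple_def fun_eq_iff)
qed

lemma factor_commute:
  assumes "s \<noteq> t" "s \<in> S" "t \<in> S" "a \<in> carrier (A s)" "c \<in> carrier (A t)"
  shows "factor s a \<otimes>\<^bsub>W\<^esub> factor t c = factor t c \<otimes>\<^bsub>W\<^esub> factor s a"
  using assms by (auto simp: tuple_def factor_def mult_W fun_eq_iff \<phi>_one)

lemma of_B_hom: "of_B \<in> hom B W"
  by (rule homI) (auto simp: of_B_def carrier_W mult_W fun_eq_iff \<phi>_closed A_invariant)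

lemma snd_hom: "snd \<in> hom W B"
  by (rule homI) (auto simp: carrier_W mult_W)

lemma of_B_factor_conj:
  assumes b: "b \<in> carrier B" and s: "s \<in> S" and a: "a \<in> carrier (A s)"
  shows "of_B b \<otimes>\<^bsub>W\<^esub> factor s a \<otimes>\<^bsub>W\<^esub> inv\<^bsub>W\<^esub> of_B b = factor (\<phi> b s) a"
proof -
  have "\<phi> (inv\<^bsub>B\<^esub> b) t = s \<longleftrightarrow> t = \<phi> b s" if "t \<in> S" for t
    using \<phi>_inv[OF b s] \<phi>_inv[OF b that] by auto
  then have "of_B b \<otimes>\<^bsub>W\<^esub> factor s a = factor (\<phi> b s) a \<otimes>\<^bsub>W\<^esub> of_B b"
    using b a s A_invariant[OF b s]
    by (auto simp: of_B_def factor_def tuple_def mult_W fun_eq_iff \<phi>_one \<phi>_closed A_invariant)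
  moreover have "of_B b \<in> carrier W" using hom_in_carrier[OF of_B_hom b] .
  moreover have "factor (\<phi> b s) a \<in> carrier W"
    using factor_closed[of "\<phi> b s" a] \<phi>_closed[OF b s] A_invariant[OF b s] a by simp
  ultimately show ?thesis by (simp add: W.m_assoc)
qed

lemma snd_eq_one_imp_tuple:
  assumes "w \<in> carrier W" "snd w = \<one>\<^bsub>B\<^esub>"
  shows "w = tuple {s \<in> S. fst w s \<noteq> \<one>\<^bsub>A s\<^esub>} (fst w)"
  using assms by (cases w) (auto simp: tuple_def carrier_W fun_eq_iff extensional_def)

lemma orbit_subset: "s \<in> S \<Longrightarrow> orbit B \<phi> s \<subseteq> S"
  by (auto simp: orbit_def \<phi>_closed)

lemma self_in_orbit: "s \<in> S \<Longrightarrow> s \<in> orbit B \<phi> s"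
  using \<phi>_one by (force simp: orbit_def)

lemma A_orbit: "s \<in> S \<Longrightarrow> t \<in> orbit B \<phi> s \<Longrightarrow> A t = A s"
  by (auto simp: orbit_def A_invariant)

lemma orbit_closed:
  assumes s: "s \<in> S" and b: "b \<in> carrier B" and t: "t \<in> orbit B \<phi> s"
  shows "\<phi> b t \<in> orbit B \<phi> s"
proof -
  obtain c where c: "c \<in> carrier B" "t = \<phi> c s" using t by (auto simp: orbit_def)
  then have "\<phi> b t = \<phi> (b \<otimes>\<^bsub>B\<^esub> c) s" using act.composition_rule[OF s b c(1)] by simp
  then show ?thesis using b c(1) unfolding orbit_def by blast
qed


section \<open>Quotients and quasimorphisms of a permutational product\<close>

lemma fixed_factor_is_quotient:
  assumes s: "s \<in> S" and fixed: "\<forall>b\<in>carrier B. \<phi> b s = s"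
  shows "(\<lambda>w. fst w s) \<in> hom W (A s)" "(\<lambda>w. fst w s) ` carrier W = carrier (A s)"
proof -
  show "(\<lambda>w. fst w s) \<in> hom W (A s)"
    using s fixed by (intro homI) (auto simp: carrier_W mult_W)
  have "a \<in> (\<lambda>w. fst w s) ` carrier W" if "a \<in> carrier (A s)" for a
    using factor_closed[OF s that] s by (intro image_eqI[of _ _ "factor s a"]) (auto simp: factor_def tuple_def)
  then show "(\<lambda>w. fst w s) ` carrier W = carrier (A s)"
    using s by (auto simp: carrier_W)
qed

text \<open>
  Summing \<open>q\<close> over the coordinates in the orbit of \<open>s\<close> is compatible with the permutation of these
  coordinates. Because \<open>q\<close> vanishes at the identity, only finitely many coordinates contribute. The defect is
  a sum of defects of \<open>q\<close>, one for each of these: it is bounded if the orbit is finite, and zero if \<open>q\<close> is a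
  homomorphism.
\<close>

lemma quasimorphism_orbit_sum:
  assumes s: "s \<in> S" and q1: "q \<one>\<^bsub>A s\<^esub> = 0"
    and q: "\<And>a c. a \<in> carrier (A s) \<Longrightarrow> c \<in> carrier (A s) \<Longrightarrow> \<bar>q (a \<otimes>\<^bsub>A s\<^esub> c) - q a - q c\<bar> \<le> C"
    and fin: "finite (orbit B \<phi> s) \<or> C = 0"
  obtains Q :: "('s \<Rightarrow> 'a) \<times> 'b \<Rightarrow> real" where
    "quasimorphism W Q" "\<And>a. a \<in> carrier (A s) \<Longrightarrow> Q (factor s a) = q a"
proof -
  let ?O = "orbit B \<phi> s"
  define supp where "supp n = {t \<in> ?O. n t \<noteq> \<one>\<^bsub>A s\<^esub>}" for n :: "'s \<Rightarrow> 'a"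
  define Q where "Q w = (\<Sum>t\<in>supp (fst w). q (fst w t))" for w :: "('s \<Rightarrow> 'a) \<times> 'b"
  have O: "?O \<subseteq> S" and A_O: "\<And>t. t \<in> ?O \<Longrightarrow> A t = A s"
    using orbit_subset[OF s] A_orbit[OF s] by auto
  have fin_supp: "finite (supp n)" if "(n, b) \<in> carrier W" for n b
    by (rule finite_subset[of _ "{s \<in> S. n s \<noteq> \<one>\<^bsub>A s\<^esub>}"]) (use that O A_O in \<open>auto simp: supp_def carrier_W\<close>)
  have Q_eq: "Q (n, b) = (\<Sum>t\<in>T. q (n t))" if "finite T" "T \<subseteq> ?O" "supp n \<subseteq> T" for n b T
    unfolding Q_def fst_conv using that q1 by (intro sum.mono_neutral_left) (auto simp: supp_def)
  have C: "C \<ge> 0" using q[of "\<one>\<^bsub>A s\<^esub>" "\<one>\<^bsub>A s\<^esub>"] s by auto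
  have "quasimorphism W Q"
  proof (rule quasimorphismI)
    fix w w' assume w: "w \<in> carrier W" and w': "w' \<in> carrier W"
    obtain n b n' b' where eq: "w = (n, b)" "w' = (n', b')" by (metis prod.exhaust)
    have b: "b \<in> carrier B" "inv\<^bsub>B\<^esub> b \<in> carrier B" using w by (auto simp: eq carrier_W)
    define m where "m = (\<lambda>t\<in>S. n t \<otimes>\<^bsub>A t\<^esub> n' (\<phi> (inv\<^bsub>B\<^esub> b) t))"
    have prod: "w \<otimes>\<^bsub>W\<^esub> w' = (m, b \<otimes>\<^bsub>B\<^esub> b')" by (simp add: eq mult_W m_def)
    define T where "T = supp n \<union> supp m \<union> \<phi> b ` supp n'"
    have T: "finite T" "T \<subseteq> ?O"
      using fin_supp[of n b] fin_supp[of n' b'] fin_supp[of m "b \<otimes>\<^bsub>B\<^esub> b'"] w w'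
        W.m_closed[OF w w'] orbit_closed[OF s b(1)]
      unfolding prod unfolding eq by (auto simp: T_def supp_def)
    have inj: "inj_on (\<phi> (inv\<^bsub>B\<^esub> b)) T"
      using act.inj_prop[OF b(2)] T(2) O by (meson inj_on_subset subset_trans)
    have "supp n' \<subseteq> \<phi> (inv\<^bsub>B\<^esub> b) ` T"
    proof
      fix t assume "t \<in> supp n'"
      then have "\<phi> b t \<in> T" "\<phi> (inv\<^bsub>B\<^esub> b) (\<phi> b t) = t"
        using \<phi>_inv(1)[OF b(1)] O by (auto simp: T_def supp_def)
      then show "t \<in> \<phi> (inv\<^bsub>B\<^esub> b) ` T" by force
    qed
    then have "Q w' = (\<Sum>t\<in>\<phi> (inv\<^bsub>B\<^esub> b) ` T. q (n' t))"
      unfolding eq using T orbit_closed[OF s b(2)] by (intro Q_eq) auto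
    also have "\<dots> = (\<Sum>t\<in>T. q (n' (\<phi> (inv\<^bsub>B\<^esub> b) t)))"
      using inj by (simp add: sum.reindex)
    finally have Qw': "Q w' = (\<Sum>t\<in>T. q (n' (\<phi> (inv\<^bsub>B\<^esub> b) t)))" .
    have Qw: "Q w = (\<Sum>t\<in>T. q (n t))" and Qp: "Q (w \<otimes>\<^bsub>W\<^esub> w') = (\<Sum>t\<in>T. q (m t))"
      unfolding prod unfolding eq using T by (auto intro!: Q_eq simp: T_def)
    have "\<bar>Q (w \<otimes>\<^bsub>W\<^esub> w') - Q w - Q w'\<bar> = \<bar>\<Sum>t\<in>T. q (m t) - q (n t) - q (n' (\<phi> (inv\<^bsub>B\<^esub> b) t))\<bar>"
      by (simp add: Qw Qw' Qp sum_subtractf)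
    also have "\<dots> \<le> (\<Sum>t\<in>T. \<bar>q (m t) - q (n t) - q (n' (\<phi> (inv\<^bsub>B\<^esub> b) t))\<bar>)"
      by (rule sum_abs)
    also have "\<dots> \<le> (\<Sum>t\<in>T. C)"
    proof (rule sum_mono)
      fix t assume "t \<in> T"
      then have t: "t \<in> S" "t \<in> ?O" "A t = A s" using T(2) O A_O by auto
      have "\<phi> (inv\<^bsub>B\<^esub> b) t \<in> S" "A (\<phi> (inv\<^bsub>B\<^esub> b) t) = A s"
        using \<phi>_closed[OF b(2) t(1)] A_invariant[OF b(2) t(1)] t by auto
      then have "n t \<in> carrier (A s)" "n' (\<phi> (inv\<^bsub>B\<^esub> b) t) \<in> carrier (A s)"
        using w w' t by (auto simp: eq carrier_W)
      then show "\<bar>q (m t) - q (n t) - q (n' (\<phi> (inv\<^bsub>B\<^esub> b) t))\<bar> \<le> C"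
        using q t by (simp add: m_def)
    qed
    also have "\<dots> \<le> real (card ?O) * C"
      using fin C T card_mono[of ?O T] by (cases "C = 0") (auto intro: mult_right_mono)
    finally show "\<bar>Q (w \<otimes>\<^bsub>W\<^esub> w') - Q w - Q w'\<bar> \<le> real (card ?O) * C" .
  qed
  moreover have "Q (factor s a) = q a" if "a \<in> carrier (A s)" for a
  proof -
    have "supp (fst (factor s a)) \<subseteq> {s}"
    proof
      fix t assume "t \<in> supp (fst (factor s a))"
      then have "t \<in> S" "A t = A s" "fst (factor s a) t \<noteq> \<one>\<^bsub>A s\<^esub>" using O A_O by (auto simp: supp_def)
      then show "t \<in> {s}" by (simp add: factor_def tuple_def split: if_splits)
    qed
    then have "Q (fst (factor s a), snd (factor s a)) = (\<Sum>t\<in>{s}. q (fst (factor s a) t))"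
      using self_in_orbit[OF s] by (intro Q_eq) simp_all
    then show ?thesis using s by (simp add: factor_def tuple_def)
  qed
  ultimately show thesis using that by blast
qed


section \<open>Loxodromic elements in the direct sum\<close>

context
  fixes D \<delta>
  assumes hyp: "hyperbolic_group_metric W D \<delta>"
begin

interpretation hyperbolic_group_metric W D \<delta> by (rule hyp)

text \<open>
  An element of the direct sum is a product of commuting elements of the factors, and the translation length
  is subadditive on commuting elements.
\<close>

lemma loxodromic_factor:
  assumes w: "w \<in> carrier W" "snd w = \<one>\<^bsub>B\<^esub>" and pos: "translation_length w > 0"
  obtains s a where "s \<in> S" "a \<in> carrier (A s)" "translation_length (factor s a) > 0"
proof -
  have "\<exists>s\<in>F. translation_length (factor s (x s)) > 0"
    if "finite F" "F \<subseteq> S" "\<And>s. s \<in> F \<Longrightarrow> x s \<in> carrier (A s)" "translation_length (tuple F x) > 0" for F x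
    using that
  proof (induction F)
    case empty
    then show ?case
      using translation_length_le[OF W.one_closed, of 1] by (simp add: tuple_empty)
  next
    case (insert r F)
    have fr: "factor r (x r) \<in> carrier W" and tF: "tuple F x \<in> carrier W"
      using insert.prems insert.hyps by (auto intro: factor_closed tuple_closed)
    have "translation_length (tuple (insert r F) x) \<le> translation_length (factor r (x r)) + translation_length (tuple F x)"
      using tuple_insert[of r F x] insert.hyps insert.prems translation_length_mult_commuting[OF fr tF] by auto
    then have "translation_length (factor r (x r)) > 0 \<or> translation_length (tuple F x) > 0"
      using insert.prems(3) by linarith
    then show ?case using insert by auto
  qed
  from this[of "{s \<in> S. fst w s \<noteq> \<one>\<^bsub>A s\<^esub>}" "fst w"] show thesis
    using that w pos snd_eq_one_imp_tuple[OF w] by (cases w) (auto simp: carrier_W)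
qed

text \<open>
  The conjugate of a loxodromic element of \<open>A s\<close> by \<open>b\<close> is a loxodromic element of \<open>A (\<phi> b s)\<close>. Every
  other factor commutes with it and hence fixes its ends, so the stabilizer of such an end can serve as \<open>P\<close>.
\<close>

lemma quasimorphism_on_other_factors:
  assumes s: "s \<in> S" and a: "a \<in> carrier (A s)" and pos: "translation_length (factor s a) > 0"
    and b: "b \<in> carrier B" "\<phi> b s \<noteq> s"
  obtains P p where "subgroup P W" "homogeneous_quasimorphism (W\<lparr>carrier := P\<rparr>) p"
    "\<And>c. c \<in> P \<Longrightarrow> \<bar>p c\<bar> = translation_length c"
    "\<And>r c. r \<in> S \<Longrightarrow> r \<noteq> \<phi> b s \<Longrightarrow> c \<in> carrier (A r) \<Longrightarrow> factor r c \<in> P"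
proof -
  let ?t = "\<phi> b s"
  have t: "?t \<in> S" "A ?t = A s" using \<phi>_closed A_invariant b(1) s by auto
  interpret A: group "A s" by (rule group_factor[OF s])
  have at: "a \<in> carrier (A ?t)" using a t by simp
  have of_B: "of_B b \<in> carrier W" using hom_in_carrier[OF of_B_hom b(1)] .
  have "translation_length (factor ?t a) > 0"
    using translation_length_conj[OF factor_closed[OF s a] of_B] of_B_factor_conj[OF b(1) s a] pos by simp
  then obtain j :: nat where h: "straight (factor ?t a [^]\<^bsub>W\<^esub> j)"
    using straight_power[OF factor_closed[OF t(1) at]] by metis
  have pow: "factor ?t a [^]\<^bsub>W\<^esub> j = factor ?t (a [^]\<^bsub>A s\<^esub> j)"
    using hom_nat_pow[OF factor_hom[OF t(1)] at] group_factor[OF t(1)] t(2) W.is_group by simp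
  let ?h = "factor ?t a [^]\<^bsub>W\<^esub> j"
  obtain p where "homogeneous_quasimorphism (W\<lparr>carrier := end_stabilizer ?h\<rparr>) p"
    "\<And>c. c \<in> end_stabilizer ?h \<Longrightarrow> \<bar>p c\<bar> = translation_length c"
    using busemann_homogeneous_quasimorphism[OF h] by metis
  moreover have "factor r c \<in> end_stabilizer ?h" if "r \<in> S" "r \<noteq> ?t" "c \<in> carrier (A r)" for r c
    using end_stabilizer_commuting[OF h factor_closed[OF that(1,3)]]
      factor_commute[OF that(2,1) t(1) that(3), of "a [^]\<^bsub>A s\<^esub> j"] a t
    by (simp add: pow)
  ultimately show thesis using that subgroup_end_stabilizer[OF h] by blast
qed

lemma quasimorphism_on_factor:
  assumes "subgroup P W" and p: "homogeneous_quasimorphism (W\<lparr>carrier := P\<rparr>) p"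
    and s: "s \<in> S" and P: "\<And>c. c \<in> carrier (A s) \<Longrightarrow> factor s c \<in> P"
  shows "homogeneous_quasimorphism (A s) (\<lambda>c. p (factor s c))"
proof (rule homogeneous_quasimorphism_comp_hom[OF p])
  show "factor s \<in> hom (A s) (W\<lparr>carrier := P\<rparr>)"
    using factor_hom[OF s] P by (auto simp: hom_def)
  show "group (W\<lparr>carrier := P\<rparr>)"
    using subgroup.subgroup_is_group[OF assms(1) W.is_group] .
qed (rule group_factor[OF s])

lemma unbounded_quasimorphism_of_loxodromic_factor:
  assumes s: "s \<in> S" and a: "a \<in> carrier (A s)" and pos: "translation_length (factor s a) > 0"
    and b: "b \<in> carrier B" "\<phi> b s \<noteq> s"
  obtains q where "quasimorphism (A s) q" "\<not> bounded (q ` carrier (A s))"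
proof -
  obtain P p where P: "subgroup P W" and p: "homogeneous_quasimorphism (W\<lparr>carrier := P\<rparr>) p"
    and abs: "\<And>c. c \<in> P \<Longrightarrow> \<bar>p c\<bar> = translation_length c"
    and factor_P: "\<And>r c. r \<in> S \<Longrightarrow> r \<noteq> \<phi> b s \<Longrightarrow> c \<in> carrier (A r) \<Longrightarrow> factor r c \<in> P"
    using quasimorphism_on_other_factors[OF assms] by metis
  have q: "homogeneous_quasimorphism (A s) (\<lambda>c. p (factor s c))"
    using quasimorphism_on_factor[OF P p s] factor_P[OF s] b(2) by metis
  moreover have "p (factor s a) \<noteq> 0" using abs[OF factor_P[OF s _ a]] b(2) pos by force
  ultimately show thesis
    using that group.homogeneous_quasimorphism_unbounded[OF group_factor[OF s] q a]
    unfolding homogeneous_quasimorphism_def by blast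
qed

text \<open>
  Restricting a Busemann quasimorphism \<open>p\<close> to the copies of \<open>A s\<close> in the orbit gives homogeneous
  quasimorphisms that have the same absolute value, the translation length, because the copies are
  conjugate; so they agree up to sign. On a sum of \<open>k\<close> copies the defects add up to \<open>k\<close> times
  the defect of a single copy, where a pair \<open>(c, e)\<close> is replaced by \<open>(e\<inverse>, c\<inverse>)\<close> in the copies with the
  opposite sign. As the defect of \<open>p\<close> is finite, the defect on a single copy must be zero.
\<close>

lemma unbounded_hom_of_loxodromic_factor:
  assumes s: "s \<in> S" and a: "a \<in> carrier (A s)" and pos: "translation_length (factor s a) > 0"
    and inf: "infinite (orbit B \<phi> s)"
  obtains h where "h \<in> hom (A s) real_group" "\<not> bounded (h ` carrier (A s))"
proof -
  interpret A: group "A s" by (rule group_factor[OF s])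
  let ?O = "orbit B \<phi> s"
  have "\<exists>t\<in>?O. t \<noteq> s"
  proof (rule ccontr)
    assume "\<not> ?thesis"
    then have "?O \<subseteq> {s}" by blast
    then show False using inf by (meson finite.simps finite_subset)
  qed
  then obtain b where b: "b \<in> carrier B" "\<phi> b s \<noteq> s" by (auto simp: orbit_def)
  let ?t = "\<phi> b s"
  obtain P p where "subgroup P W" and p: "homogeneous_quasimorphism (W\<lparr>carrier := P\<rparr>) p"
    and abs: "\<And>c. c \<in> P \<Longrightarrow> \<bar>p c\<bar> = translation_length c"
    and factor_P: "\<And>r c. r \<in> S \<Longrightarrow> r \<noteq> ?t \<Longrightarrow> c \<in> carrier (A r) \<Longrightarrow> factor r c \<in> P"
    using quasimorphism_on_other_factors[OF s a pos b] by metis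
  interpret P: subgroup P W by fact
  interpret PG: group "W\<lparr>carrier := P\<rparr>" by (rule P.subgroup_is_group) (rule W.is_group)
  obtain C where C: "\<And>c e. c \<in> P \<Longrightarrow> e \<in> P \<Longrightarrow> \<bar>p (c \<otimes>\<^bsub>W\<^esub> e) - p c - p e\<bar> \<le> C"
  proof -
    have "quasimorphism (W\<lparr>carrier := P\<rparr>) p"
      using p by (simp add: homogeneous_quasimorphism_def)
    then show thesis
    proof (rule quasimorphismE)
      fix E
      assume "\<And>c e. c \<in> carrier (W\<lparr>carrier := P\<rparr>) \<Longrightarrow> e \<in> carrier (W\<lparr>carrier := P\<rparr>) \<Longrightarrow>
        \<bar>p (c \<otimes>\<^bsub>W\<lparr>carrier := P\<rparr>\<^esub> e) - p c - p e\<bar> \<le> E"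
      then show thesis by (intro that[of E]) simp
    qed
  qed
  define R where "R = ?O - {?t}"
  have R: "R \<subseteq> S" "\<And>r. r \<in> R \<Longrightarrow> A r = A s" "infinite R" "\<And>r. r \<in> R \<Longrightarrow> r \<noteq> ?t"
    using orbit_subset[OF s] A_orbit[OF s] inf by (auto simp: R_def)
  have sR: "s \<in> R" using self_in_orbit[OF s] b by (auto simp: R_def)
  define p' where "p' r c = p (factor r c)" for r c
  have hq: "homogeneous_quasimorphism (A s) (p' r)" if "r \<in> R" for r
    using quasimorphism_on_factor[OF \<open>subgroup P W\<close> p, of r] factor_P[of r] that R unfolding p'_def by auto
  have abs': "\<bar>p' r c\<bar> = translation_length (factor s c)" if r: "r \<in> R" and c: "c \<in> carrier (A s)" for r c
  proof -
    obtain d where d: "d \<in> carrier B" "r = \<phi> d s" using r by (auto simp: R_def orbit_def)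
    have "\<bar>p' r c\<bar> = translation_length (factor r c)"
      unfolding p'_def using R r c by (intro abs factor_P) auto
    also have "\<dots> = translation_length (factor s c)"
      using translation_length_conj[OF factor_closed[OF s c] hom_in_carrier[OF of_B_hom d(1)]]
        of_B_factor_conj[OF d(1) s c] d(2) by simp
    finally show ?thesis .
  qed
  have sign: "(\<forall>c\<in>carrier (A s). p' r c = p' s c) \<or> (\<forall>c\<in>carrier (A s). p' r c = - p' s c)" if r: "r \<in> R" for r
    using A.homogeneous_quasimorphisms_eq_or_minus[OF hq[OF sR] hq[OF r]] abs'[OF sR] abs'[OF r] by simp
  have p_tuple: "p (tuple F x) = (\<Sum>r\<in>F. p' r (x r)) \<and> tuple F x \<in> P"
    if "finite F" "F \<subseteq> R" "\<And>r. r \<in> F \<Longrightarrow> x r \<in> carrier (A s)" for F x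
    using that
  proof (induction F)
    case empty
    then show ?case using PG.homogeneous_quasimorphism_one[OF p] P.one_closed by (simp add: tuple_empty)
  next
    case (insert r F)
    have IH: "p (tuple F x) = (\<Sum>r\<in>F. p' r (x r))" "tuple F x \<in> P" using insert by auto
    have fr: "factor r (x r) \<in> P" using insert.prems R by (intro factor_P) auto
    have x: "x u \<in> carrier (A u)" if "u \<in> insert r F" for u
      using insert.prems(1) insert.prems(2)[OF that] R(2)[of u] that by auto
    have t: "tuple (insert r F) x = factor r (x r) \<otimes>\<^bsub>W\<^esub> tuple F x"
      "factor r (x r) \<otimes>\<^bsub>W\<^esub> tuple F x = tuple F x \<otimes>\<^bsub>W\<^esub> factor r (x r)"
      using tuple_insert[of r F x] x insert.hyps insert.prems(1) R(1) by blast+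
    have "p (factor r (x r) \<otimes>\<^bsub>W\<^esub> tuple F x) = p (factor r (x r)) + p (tuple F x)"
      using PG.homogeneous_quasimorphism_commuting[OF p, of "factor r (x r)" "tuple F x"] fr IH(2) t(2) by simp
    then show ?case
      using insert.hyps IH fr P.m_closed by (simp add: t(1) p'_def)
  qed
  have additive: "p' s (c \<otimes>\<^bsub>A s\<^esub> e) = p' s c + p' s e"
    if c: "c \<in> carrier (A s)" and e: "e \<in> carrier (A s)" for c e
  proof -
    let ?d = "p' s (c \<otimes>\<^bsub>A s\<^esub> e) - p' s c - p' s e"
    define same where "same r \<longleftrightarrow> (\<forall>c\<in>carrier (A s). p' r c = p' s c)" for r
    \<comment> \<open>Replacing \<open>(c, e)\<close> by \<open>(e\<inverse>, c\<inverse>)\<close> changes the sign of the defect, as does the sign of \<open>p' r\<close>.\<close>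
    define x where "x r = (if same r then c else inv\<^bsub>A s\<^esub> e)" for r
    define y where "y r = (if same r then e else inv\<^bsub>A s\<^esub> c)" for r
    have xy: "x r \<in> carrier (A s)" "y r \<in> carrier (A s)" for r
      using c e by (auto simp: x_def y_def)
    have defect: "p' r (x r \<otimes>\<^bsub>A s\<^esub> y r) - p' r (x r) - p' r (y r) = ?d" if r: "r \<in> R" for r
    proof (cases "same r")
      case True
      then show ?thesis using c e by (simp add: x_def y_def same_def)
    next
      case False
      then have "\<And>c. c \<in> carrier (A s) \<Longrightarrow> p' r c = - p' s c" using sign[OF r] by (auto simp: same_def)
      moreover have "inv\<^bsub>A s\<^esub> e \<otimes>\<^bsub>A s\<^esub> inv\<^bsub>A s\<^esub> c = inv\<^bsub>A s\<^esub> (c \<otimes>\<^bsub>A s\<^esub> e)"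
        using c e by (simp add: A.inv_mult_group)
      ultimately show ?thesis
        using False c e A.homogeneous_quasimorphism_inv[OF hq[OF sR]] by (simp add: x_def y_def)
    qed
    have "\<bar>?d\<bar> \<le> 0"
    proof (rule le_of_linear_growth_le)
      fix k :: nat
      obtain F where F: "finite F" "card F = k" "F \<subseteq> R"
        using infinite_arbitrarily_large[OF R(3)] by blast
      have x_F: "x r \<in> carrier (A r)" "y r \<in> carrier (A r)" if "r \<in> F" for r
        using xy[of r] R(2)[of r] F(3) that by auto
      have "tuple F x \<otimes>\<^bsub>W\<^esub> tuple F y = tuple F (\<lambda>r. x r \<otimes>\<^bsub>A r\<^esub> y r)"
        using x_F by (intro tuple_mult)
      also have "\<dots> = tuple F (\<lambda>r. x r \<otimes>\<^bsub>A s\<^esub> y r)"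
        using F(3) R(2) by (auto simp: tuple_def fun_eq_iff)
      finally have prod: "tuple F x \<otimes>\<^bsub>W\<^esub> tuple F y = tuple F (\<lambda>r. x r \<otimes>\<^bsub>A s\<^esub> y r)" .
      have "p (tuple F x \<otimes>\<^bsub>W\<^esub> tuple F y) - p (tuple F x) - p (tuple F y)
          = (\<Sum>r\<in>F. p' r (x r \<otimes>\<^bsub>A s\<^esub> y r) - p' r (x r) - p' r (y r))"
        using p_tuple[OF F(1,3)] xy by (simp add: prod sum_subtractf)
      also have "\<dots> = real k * ?d"
        using defect F by (simp add: subset_iff)
      finally have "real k * \<bar>?d\<bar> = \<bar>p (tuple F x \<otimes>\<^bsub>W\<^esub> tuple F y) - p (tuple F x) - p (tuple F y)\<bar>"
        by (simp add: abs_mult)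
      then show "real k * \<bar>?d\<bar> \<le> real k * 0 + C"
        using C[of "tuple F x" "tuple F y"] p_tuple[OF F(1,3)] xy by simp
    qed
    then show ?thesis by simp
  qed
  have "p' s \<in> hom (A s) real_group"
    using additive by (simp add: hom_def real_group_def)
  moreover have "p' s a \<noteq> 0" using abs'[OF sR a] pos by linarith
  ultimately show thesis
    using that A.homogeneous_quasimorphism_unbounded[OF hq[OF sR] a] by blast
qed

end

end


section \<open>The characterization\<close>

lemma property_NL_no_loxodromic_in_subgroup:
  assumes NL: "property_NL H" and f: "f \<in> hom H G" and "group H" "group G"
    and hyp: "hyperbolic_space M d" and act: "isometric_action G M d \<rho>" and x: "x \<in> M"
    and hgm: "hyperbolic_group_metric G (\<lambda>a b. d (\<rho> a x) (\<rho> b x)) \<delta>" and h: "h \<in> carrier H"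
  shows "\<not> hyperbolic_group_metric.translation_length G (\<lambda>a b. d (\<rho> a x) (\<rho> b x)) (f h) > 0"
proof
  assume "hyperbolic_group_metric.translation_length G (\<lambda>a b. d (\<rho> a x) (\<rho> b x)) (f h) > 0"
  then have "loxodromic G M d \<rho> (f h)"
    using translation_length_pos_iff[where \<rho> = \<rho> and d = d, OF hgm act x hom_in_carrier[OF f h]] x
    unfolding loxodromic_def by blast
  then have "loxodromic H M d (\<rho> \<circ> f) h" using loxodromic_comp_hom[OF f assms(3,4) h] by blast
  then show False
    using property_NL_all_spaces[OF NL hyp isometric_action_comp_hom[OF act f assms(3)]] h by blast
qed

theorem theorem4p14:
  fixes B :: "'b monoid" and S :: "'s set" and \<phi> :: "'b \<Rightarrow> 's \<Rightarrow> 's" and A :: "'s \<Rightarrow> 'a monoid"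
  assumes "group B"
    and "group_action B S \<phi>"
    and "invariant_family B S \<phi> A"
  shows "property_NL (permutational_product B S \<phi> A) \<longleftrightarrow>
     property_NL B \<and>
     (\<forall>s\<in>S. (\<forall>b\<in>carrier B. \<phi> b s = s) \<longrightarrow> property_NL (A s)) \<and>
     (\<forall>s\<in>S. finite (orbit B \<phi> s) \<longrightarrow>
        \<not> (\<exists>q. quasimorphism (A s) q \<and> \<not> bounded (q ` carrier (A s)))) \<and>
     (\<forall>s\<in>S. infinite (orbit B \<phi> s) \<longrightarrow>
        \<not> (\<exists>h. h \<in> hom (A s) real_group \<and> \<not> bounded (h ` carrier (A s))))"
    (is "_ \<longleftrightarrow> ?B \<and> ?fixed \<and> ?finite \<and> ?infinite")
proof
  interpret permutational_product_group B S \<phi> A by (rule permutational_product_group.intro) (fact assms)+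
  assume NL: "property_NL (permutational_product B S \<phi> A)"
  have bounded_factor: "bounded (q ` carrier (A s))"
    if s: "s \<in> S" and one: "q \<one>\<^bsub>A s\<^esub> = 0"
      and C: "\<And>a c. a \<in> carrier (A s) \<Longrightarrow> c \<in> carrier (A s) \<Longrightarrow> \<bar>q (a \<otimes>\<^bsub>A s\<^esub> c) - q a - q c\<bar> \<le> C"
      and fin: "finite (orbit B \<phi> s) \<or> C = 0" for s C and q :: "'a \<Rightarrow> real"
  proof -
    obtain Q where Q: "quasimorphism W Q" "\<And>a. a \<in> carrier (A s) \<Longrightarrow> Q (factor s a) = q a"
      using quasimorphism_orbit_sum[OF s one C fin] by blast
    have "q ` carrier (A s) \<subseteq> Q ` carrier W"
      using Q(2) factor_closed[OF s] by force
    then show ?thesis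
      using property_NL_imp_quasimorphisms_bounded[OF W.is_group NL Q(1)] bounded_subset by blast
  qed
  show "?B \<and> ?fixed \<and> ?finite \<and> ?infinite"
  proof (intro conjI ballI impI notI)
    have "b \<in> snd ` carrier W" if "b \<in> carrier B" for b
      using hom_in_carrier[OF of_B_hom that] by (force simp: of_B_def)
    then have "snd ` carrier W = carrier B" using hom_in_carrier[OF snd_hom] by blast
    then show "property_NL B"
      using property_NL_quotient[OF NL snd_hom _ W.is_group B.is_group] by blast
  next
    fix s assume s: "s \<in> S" and fixed: "\<forall>b\<in>carrier B. \<phi> b s = s"
    show "property_NL (A s)"
      using property_NL_quotient[OF NL fixed_factor_is_quotient[OF s fixed] W.is_group group_factor[OF s]] .
  next
    fix s assume s: "s \<in> S" and fin: "finite (orbit B \<phi> s)"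
      and "\<exists>q. quasimorphism (A s) q \<and> \<not> bounded (q ` carrier (A s))"
    then obtain q where q: "quasimorphism (A s) q" "\<not> bounded (q ` carrier (A s))" by blast
    interpret A: group "A s" by (rule group_factor[OF s])
    obtain p C where p: "homogeneous_quasimorphism (A s) p"
      and C: "\<And>a. a \<in> carrier (A s) \<Longrightarrow> \<bar>p a - q a\<bar> \<le> C"
      using A.homogenization[OF q(1)] by metis
    have "quasimorphism (A s) p" using p by (simp add: homogeneous_quasimorphism_def)
    then obtain E where E: "\<And>a c. a \<in> carrier (A s) \<Longrightarrow> c \<in> carrier (A s) \<Longrightarrow> \<bar>p (a \<otimes>\<^bsub>A s\<^esub> c) - p a - p c\<bar> \<le> E"
      by (rule quasimorphismE) blast
    have "bounded (p ` carrier (A s))"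
      by (rule bounded_factor[OF s A.homogeneous_quasimorphism_one[OF p] E]) (simp_all add: fin)
    then obtain K where K: "\<And>a. a \<in> carrier (A s) \<Longrightarrow> \<bar>p a\<bar> \<le> K" by (auto simp: bounded_iff)
    have "\<bar>q a\<bar> \<le> K + C" if "a \<in> carrier (A s)" for a
      using K[OF that] C[OF that] by linarith
    then show False using q(2) by (auto simp: bounded_iff)
  next
    fix s assume s: "s \<in> S"
      and "\<exists>h. h \<in> hom (A s) real_group \<and> \<not> bounded (h ` carrier (A s))"
    then obtain h where h: "h \<in> hom (A s) real_group" "\<not> bounded (h ` carrier (A s))" by blast
    have mult: "h (a \<otimes>\<^bsub>A s\<^esub> c) = h a + h c" if "a \<in> carrier (A s)" "c \<in> carrier (A s)" for a c
      using h(1) that by (auto simp: hom_def real_group_def)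
    then have "h \<one>\<^bsub>A s\<^esub> = 0" using s by (metis add_cancel_left_left one_closed_A l_one_A)
    then have "bounded (h ` carrier (A s))" using bounded_factor[OF s, of h 0] mult by simp
    then show False using h(2) by blast
  qed
next
  interpret permutational_product_group B S \<phi> A by (rule permutational_product_group.intro) (fact assms)+
  assume conditions: "?B \<and> ?fixed \<and> ?finite \<and> ?infinite"
  show "property_NL (permutational_product B S \<phi> A)"
    unfolding property_NL_def
  proof (intro allI impI notI)
    fix M :: "((('s \<Rightarrow> 'a) \<times> 'b) \<times> real) set" and d \<rho>
    assume "hyperbolic_space M d \<and> isometric_action W M d \<rho>"
    then have hyp: "hyperbolic_space M d" and act: "isometric_action W M d \<rho>" by auto
    assume "\<exists>g\<in>carrier W. loxodromic W M d \<rho> g"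
    then obtain g x where g: "g \<in> carrier W" and x: "x \<in> M" and qie:
      "quasi_isometric_embedding UNIV (\<lambda>m n. \<bar>real_of_int m - real_of_int n\<bar>) M d (\<lambda>n::int. \<rho> (g [^]\<^bsub>W\<^esub> n) x)"
      by (auto simp: loxodromic_def)
    define D where "D a b = d (\<rho> a x) (\<rho> b x)" for a b
    obtain \<delta> where hgm: "hyperbolic_group_metric W D \<delta>"
      using hyperbolic_group_metric_of_action[OF hyp act x] unfolding D_def by blast
    interpret hyperbolic_group_metric W D \<delta> by (rule hgm)
    have pos: "translation_length g > 0"
      using translation_length_pos_iff[where \<rho> = \<rho> and d = d, OF _ act x g] hgm qie unfolding D_def by blast
    \<comment> \<open>Either the direct sum contributes a loxodromic element, or the \<open>B\<close>-part of \<open>g\<close> alone is loxodromic.\<close>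
    show False
    proof (cases "\<exists>w\<in>carrier W. snd w = \<one>\<^bsub>B\<^esub> \<and> translation_length w > 0")
      case True
      then obtain s a where s: "s \<in> S" "a \<in> carrier (A s)" and sa: "translation_length (factor s a) > 0"
        using loxodromic_factor[OF hgm] by metis
      have "\<not> property_NL (A s)"
        using property_NL_no_loxodromic_in_subgroup[where \<rho> = \<rho> and d = d,
            OF _ factor_hom[OF s(1)] group_factor[OF s(1)] W.is_group hyp act x _ s(2)] hgm sa
        unfolding D_def by blast
      then obtain b where b: "b \<in> carrier B" "\<phi> b s \<noteq> s" using conditions s by blast
      show False
        using unbounded_quasimorphism_of_loxodromic_factor[OF hgm s sa b]
          unbounded_hom_of_loxodromic_factor[OF hgm s sa] conditions s(1) by metis
    next
      case False
      interpret snd: group_hom W B snd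
        using snd_hom by (simp add: group_hom_def group_hom_axioms_def W.is_group B.is_group)
      define b where "b = snd g"
      have b: "b \<in> carrier B" "of_B b \<in> carrier W"
        using snd.hom_closed[OF g] hom_in_carrier[OF of_B_hom] by (auto simp: b_def)
      have n: "inv\<^bsub>W\<^esub> g \<otimes>\<^bsub>W\<^esub> of_B b \<in> kernel W B snd"
        using g b by (simp add: kernel_def) (simp add: of_B_def b_def)
      have "translation_length (g \<otimes>\<^bsub>W\<^esub> (inv\<^bsub>W\<^esub> g \<otimes>\<^bsub>W\<^esub> of_B b)) = translation_length g"
        using False translation_length_nonneg
        by (intro translation_length_mod_normal[OF snd.normal_kernel _ g pos n]) (force simp: kernel_def)
      then have "translation_length (of_B b) > 0" using g b pos by simp
      then show False
        using property_NL_no_loxodromic_in_subgroup[where \<rho> = \<rho> and d = d,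
            OF _ of_B_hom B.is_group W.is_group hyp act x _ b(1)] hgm conditions
        unfolding D_def by blast
    qed
  qed
qed

end
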